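(* Work in ZF. For every ordinal \(\delta\), the Ketonen order on \(\mathscr F(\delta)\) is wellfounded.
   Context: A filter \(F\) on a set \(X\) is wellfounded if for every ordinal \(\gamma\) the reduced power \(\gamma^X/F\) is wellfounded. \(\mathscr F(\delta)\) is the set of wellfounded filters on \(\delta\), and \(\mathscr F(\delta,\alpha)\) the set of \(F\in\mathscr F(\delta)\) with \(\alpha\in F\) (here \(\alpha=\{\xi:\xi<\alpha\}\subseteq\delta\)). For a filter \(G\) on \(\delta\) and filters \(F_\alpha\) on \(\delta\) (\(\alpha<\delta\)), \(G\text{-}\lim_{\alpha<\delta}F_\alpha=\{B\subseteq\delta:\{\alpha<\delta:B\in F_\alpha\}\in G\}\). The Ketonen order: for \(F,G\in\mathscr F(\delta)\), \(F\lhd G\) iff there is \(\langle F_\alpha:\alpha<\delta\rangle\) with \(F_\alpha\in\mathscr F(\delta,\alpha)\) for all \(\alpha\) and \(F\subseteq G\text{-}\lim_{\alpha<\delta}F_\alpha\). Wellfounded means every nonempty subset of \(\mathscr F(\delta)\) has a \(\lhd\)-minimal element. *)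

theory Defs
  imports Main
begin

text \<open>
  HOL has choice, so "work in ZF" is rendered by quantifying over all structures
  \<open>(V, \<^bold>\<in>)\<close> that satisfy the first-order axioms of ZF; by the completeness theorem, a
  first-order sentence holds in all of them iff ZF proves it. All notions below are first-order
  over the structure: every quantifier ranges over elements of \<open>V\<close>, never over HOL sets or
  functions on \<open>V\<close>. Separation and Replacement are schemes over formulas; with arbitrary HOL
  predicates in place of formulas they would make the axiom of choice true in \<open>V\<close>.
\<close>

datatype fm = FMem nat nat | FEq nat nat | FNot fm | FAnd fm fm | FEx nat fm

primrec sat :: "('v \<Rightarrow> 'v \<Rightarrow> bool) \<Rightarrow> fm \<Rightarrow> (nat \<Rightarrow> 'v) \<Rightarrow> bool" where
  "sat mem (FMem i j) e \<longleftrightarrow> mem (e i) (e j)"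
| "sat mem (FEq i j) e \<longleftrightarrow> e i = e j"
| "sat mem (FNot p) e \<longleftrightarrow> \<not> sat mem p e"
| "sat mem (FAnd p q) e \<longleftrightarrow> sat mem p e \<and> sat mem q e"
| "sat mem (FEx i p) e \<longleftrightarrow> (\<exists>x. sat mem p (e(i := x)))"

locale set_structure =
  fixes mem :: "'v \<Rightarrow> 'v \<Rightarrow> bool" (infix "\<^bold>\<in>" 50)
begin

definition subset :: "'v \<Rightarrow> 'v \<Rightarrow> bool" (infix "\<^bold>\<subseteq>" 50) where
  "a \<^bold>\<subseteq> b \<longleftrightarrow> (\<forall>x. x \<^bold>\<in> a \<longrightarrow> x \<^bold>\<in> b)"

definition nonempty :: "'v \<Rightarrow> bool" where
  "nonempty a \<longleftrightarrow> (\<exists>x. x \<^bold>\<in> a)"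

text \<open>\<open>is_set_of a P\<close> says that \<open>a\<close> is the set \<open>{x. P x}\<close>; in particular that this class is a set.\<close>

definition is_set_of :: "'v \<Rightarrow> ('v \<Rightarrow> bool) \<Rightarrow> bool" where
  "is_set_of a P \<longleftrightarrow> (\<forall>x. x \<^bold>\<in> a \<longleftrightarrow> P x)"

definition is_pair :: "'v \<Rightarrow> 'v \<Rightarrow> 'v \<Rightarrow> bool" where
  "is_pair p x y \<longleftrightarrow>
     is_set_of p (\<lambda>z. is_set_of z (\<lambda>w. w = x) \<or> is_set_of z (\<lambda>w. w = x \<or> w = y))"

definition maps_to :: "'v \<Rightarrow> 'v \<Rightarrow> 'v \<Rightarrow> bool" where
  "maps_to f x y \<longleftrightarrow> (\<exists>p. p \<^bold>\<in> f \<and> is_pair p x y)"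

definition function_on :: "'v \<Rightarrow> 'v \<Rightarrow> bool" where
  "function_on f X \<longleftrightarrow>
     (\<forall>p. p \<^bold>\<in> f \<longrightarrow> (\<exists>x y. x \<^bold>\<in> X \<and> is_pair p x y)) \<and>
     (\<forall>x. x \<^bold>\<in> X \<longrightarrow> (\<exists>!y. maps_to f x y))"

definition function_to :: "'v \<Rightarrow> 'v \<Rightarrow> 'v \<Rightarrow> bool" where
  "function_to f X Y \<longleftrightarrow>
     function_on f X \<and> (\<forall>x y. maps_to f x y \<longrightarrow> y \<^bold>\<in> Y)"

text \<open>\<open>R\<close> is wellfounded on the class \<open>P\<close>: every nonempty \<^emph>\<open>set\<close> of the structure all of whose
  elements satisfy \<open>P\<close> has an \<open>R\<close>-minimal element.\<close>

definition wellfounded_on :: "('v \<Rightarrow> bool) \<Rightarrow> ('v \<Rightarrow> 'v \<Rightarrow> bool) \<Rightarrow> bool" where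
  "wellfounded_on P R \<longleftrightarrow>
     (\<forall>S. nonempty S \<and> (\<forall>x. x \<^bold>\<in> S \<longrightarrow> P x) \<longrightarrow>
        (\<exists>m. m \<^bold>\<in> S \<and> \<not> (\<exists>x. x \<^bold>\<in> S \<and> R x m)))"

definition ordinal :: "'v \<Rightarrow> bool" where
  "ordinal a \<longleftrightarrow>
     (\<forall>x. x \<^bold>\<in> a \<longrightarrow> x \<^bold>\<subseteq> a) \<and>
     (\<forall>x. x \<^bold>\<in> a \<longrightarrow> \<not> x \<^bold>\<in> x) \<and>
     (\<forall>x y z. x \<^bold>\<in> a \<and> y \<^bold>\<in> a \<and> z \<^bold>\<in> a \<and> x \<^bold>\<in> y \<and> y \<^bold>\<in> z \<longrightarrow> x \<^bold>\<in> z) \<and>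
     (\<forall>x y. x \<^bold>\<in> a \<and> y \<^bold>\<in> a \<longrightarrow> x \<^bold>\<in> y \<or> x = y \<or> y \<^bold>\<in> x) \<and>
     wellfounded_on (\<lambda>x. x \<^bold>\<in> a) (\<lambda>x y. x \<^bold>\<in> y)"

text \<open>Filters are proper. For wellfounded filters this is no extra condition: modulo an improper
  filter, the constant function \<open>0\<close> in \<open>1\<^sup>X\<close> would be below itself.\<close>

definition filter_on :: "'v \<Rightarrow> 'v \<Rightarrow> bool" where
  "filter_on X F \<longleftrightarrow>
     (\<forall>A. A \<^bold>\<in> F \<longrightarrow> A \<^bold>\<subseteq> X) \<and>
     X \<^bold>\<in> F \<and>
     (\<forall>A. A \<^bold>\<in> F \<longrightarrow> nonempty A) \<and>
     (\<forall>A B. A \<^bold>\<in> F \<and> A \<^bold>\<subseteq> B \<and> B \<^bold>\<subseteq> X \<longrightarrow> B \<^bold>\<in> F) \<and>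
     (\<forall>A B. A \<^bold>\<in> F \<and> B \<^bold>\<in> F \<longrightarrow> (\<exists>C. C \<^bold>\<in> F \<and> is_set_of C (\<lambda>x. x \<^bold>\<in> A \<and> x \<^bold>\<in> B)))"

text \<open>\<open>{x \<in> X. P x} \<in> F\<close>\<close>

definition almost_all :: "'v \<Rightarrow> 'v \<Rightarrow> ('v \<Rightarrow> bool) \<Rightarrow> bool" where
  "almost_all X F P \<longleftrightarrow> (\<exists>A. A \<^bold>\<in> F \<and> is_set_of A (\<lambda>x. x \<^bold>\<in> X \<and> P x))"

definition eq_mod :: "'v \<Rightarrow> 'v \<Rightarrow> 'v \<Rightarrow> 'v \<Rightarrow> bool" where
  "eq_mod X F f g \<longleftrightarrow> almost_all X F (\<lambda>x. \<exists>y z. maps_to f x y \<and> maps_to g x z \<and> y = z)"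

definition less_mod :: "'v \<Rightarrow> 'v \<Rightarrow> 'v \<Rightarrow> 'v \<Rightarrow> bool" where
  "less_mod X F f g \<longleftrightarrow> almost_all X F (\<lambda>x. \<exists>y z. maps_to f x y \<and> maps_to g x z \<and> y \<^bold>\<in> z)"

text \<open>\<open>c \<in> \<gamma>\<^sup>X/F\<close>, i.e. \<open>c\<close> is the class of some \<open>f : X \<rightarrow> \<gamma>\<close> modulo \<open>F\<close>.\<close>

definition in_reduced_power :: "'v \<Rightarrow> 'v \<Rightarrow> 'v \<Rightarrow> 'v \<Rightarrow> bool" where
  "in_reduced_power \<gamma> X F c \<longleftrightarrow>
     (\<exists>f. function_to f X \<gamma> \<and> is_set_of c (\<lambda>g. function_to g X \<gamma> \<and> eq_mod X F f g))"

definition reduced_power_less :: "'v \<Rightarrow> 'v \<Rightarrow> 'v \<Rightarrow> 'v \<Rightarrow> bool" where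
  "reduced_power_less X F c d \<longleftrightarrow> (\<exists>f g. f \<^bold>\<in> c \<and> g \<^bold>\<in> d \<and> less_mod X F f g)"

text \<open>\<open>F \<in> \<F>(X)\<close>\<close>

definition wf_filter :: "'v \<Rightarrow> 'v \<Rightarrow> bool" where
  "wf_filter X F \<longleftrightarrow>
     filter_on X F \<and>
     (\<forall>\<gamma>. ordinal \<gamma> \<longrightarrow> wellfounded_on (in_reduced_power \<gamma> X F) (reduced_power_less X F))"

text \<open>\<open>F \<in> \<F>(\<delta>,\<alpha>)\<close>\<close>

definition wf_filter_at :: "'v \<Rightarrow> 'v \<Rightarrow> 'v \<Rightarrow> bool" where
  "wf_filter_at \<delta> \<alpha> F \<longleftrightarrow> wf_filter \<delta> F \<and> \<alpha> \<^bold>\<in> F"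

text \<open>\<open>L = G-lim\<^bsub>\<alpha><\<delta>\<^esub> F\<^sub>\<alpha>\<close>, where \<open>s\<close> is the function \<open>\<alpha> \<mapsto> F\<^sub>\<alpha>\<close> on \<open>\<delta>\<close>.\<close>

definition is_filter_limit :: "'v \<Rightarrow> 'v \<Rightarrow> 'v \<Rightarrow> 'v \<Rightarrow> bool" where
  "is_filter_limit \<delta> G s L \<longleftrightarrow>
     is_set_of L (\<lambda>B. B \<^bold>\<subseteq> \<delta> \<and> almost_all \<delta> G (\<lambda>\<alpha>. \<exists>H. maps_to s \<alpha> H \<and> B \<^bold>\<in> H))"

definition ketonen_less :: "'v \<Rightarrow> 'v \<Rightarrow> 'v \<Rightarrow> bool" where
  "ketonen_less \<delta> F G \<longleftrightarrow>
     wf_filter \<delta> F \<and> wf_filter \<delta> G \<and>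
     (\<exists>s. function_on s \<delta> \<and>
        (\<forall>\<alpha> H. \<alpha> \<^bold>\<in> \<delta> \<and> maps_to s \<alpha> H \<longrightarrow> wf_filter_at \<delta> \<alpha> H) \<and>
        (\<exists>L. is_filter_limit \<delta> G s L \<and> F \<^bold>\<subseteq> L))"

text \<open>
  \<open>\<F>(\<delta>,0)\<close> is empty, since \<open>0 \<in> F\<close> makes \<open>F\<close> improper; so requiring
  \<open>F\<^sub>\<alpha> \<in> \<F>(\<delta>,\<alpha>)\<close> for literally all \<open>\<alpha> < \<delta>\<close> makes \<open>ketonen_less\<close> the empty relation (see
  \<open>not_ketonen_less\<close> below). The order that is evidently meant requires it for \<open>G\<close>-almost all
  \<open>\<alpha>\<close>; note that \<open>G-lim\<^bsub>\<alpha><\<delta>\<^esub> F\<^sub>\<alpha>\<close> depends only on the values of \<open>F\<^sub>\<alpha>\<close> on a set in \<open>G\<close>.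
\<close>

definition ketonen_less_ae :: "'v \<Rightarrow> 'v \<Rightarrow> 'v \<Rightarrow> bool" where
  "ketonen_less_ae \<delta> F G \<longleftrightarrow>
     wf_filter \<delta> F \<and> wf_filter \<delta> G \<and>
     (\<exists>s. function_on s \<delta> \<and>
        (\<forall>\<alpha> H. \<alpha> \<^bold>\<in> \<delta> \<and> maps_to s \<alpha> H \<longrightarrow> filter_on \<delta> H) \<and>
        almost_all \<delta> G (\<lambda>\<alpha>. \<exists>H. maps_to s \<alpha> H \<and> wf_filter_at \<delta> \<alpha> H) \<and>
        (\<exists>L. is_filter_limit \<delta> G s L \<and> F \<^bold>\<subseteq> L))"

lemma filter_onD:
  assumes "filter_on X F"
  shows "X \<^bold>\<in> F" and "A \<^bold>\<in> F \<Longrightarrow> nonempty A"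
  using assms unfolding filter_on_def by iprover+

lemma function_onD: "function_on f X \<Longrightarrow> x \<^bold>\<in> X \<Longrightarrow> \<exists>y. maps_to f x y"
  by (auto simp: function_on_def)

lemma ketonen_less_imp_ae:
  assumes "ketonen_less \<delta> F G"
  shows "ketonen_less_ae \<delta> F G"
proof -
  obtain s where fn: "function_on s \<delta>"
      and s: "\<And>\<alpha> H. \<alpha> \<^bold>\<in> \<delta> \<Longrightarrow> maps_to s \<alpha> H \<Longrightarrow> wf_filter_at \<delta> \<alpha> H"
      and lim: "\<exists>L. is_filter_limit \<delta> G s L \<and> F \<^bold>\<subseteq> L"
    using assms by (auto simp: ketonen_less_def)
  have FG: "wf_filter \<delta> F" "wf_filter \<delta> G"
    using assms by (simp_all add: ketonen_less_def)
  have "\<delta> \<^bold>\<in> G"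
    using FG(2) by (auto simp: wf_filter_def intro: filter_onD(1))
  moreover have "\<exists>H. maps_to s \<alpha> H \<and> wf_filter_at \<delta> \<alpha> H" if "\<alpha> \<^bold>\<in> \<delta>" for \<alpha>
    using function_onD[OF fn that] s[OF that] by blast
  then have "is_set_of \<delta> (\<lambda>\<alpha>. \<alpha> \<^bold>\<in> \<delta> \<and> (\<exists>H. maps_to s \<alpha> H \<and> wf_filter_at \<delta> \<alpha> H))"
    by (auto simp: is_set_of_def)
  ultimately have "almost_all \<delta> G (\<lambda>\<alpha>. \<exists>H. maps_to s \<alpha> H \<and> wf_filter_at \<delta> \<alpha> H)"
    unfolding almost_all_def by (intro exI conjI)
  moreover have "filter_on \<delta> H" if "\<alpha> \<^bold>\<in> \<delta>" "maps_to s \<alpha> H" for \<alpha> H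
    using s[OF that] by (simp add: wf_filter_at_def wf_filter_def)
  ultimately show ?thesis
    using FG fn lim unfolding ketonen_less_ae_def by blast
qed

end

locale ZF_model = set_structure +
  assumes extensionality: "(\<forall>x. x \<^bold>\<in> a \<longleftrightarrow> x \<^bold>\<in> b) \<Longrightarrow> a = b"
    and foundation: "nonempty a \<Longrightarrow> \<exists>x. x \<^bold>\<in> a \<and> \<not> (\<exists>z. z \<^bold>\<in> x \<and> z \<^bold>\<in> a)"
    and pairing: "\<exists>c. is_set_of c (\<lambda>x. x = a \<or> x = b)"
    and union: "\<exists>c. is_set_of c (\<lambda>x. \<exists>y. y \<^bold>\<in> a \<and> x \<^bold>\<in> y)"
    and power_set: "\<exists>c. is_set_of c (\<lambda>x. x \<^bold>\<subseteq> a)"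
    and infinity: "\<exists>a. (\<exists>z. z \<^bold>\<in> a \<and> \<not> nonempty z) \<and>
      (\<forall>x. x \<^bold>\<in> a \<longrightarrow> (\<exists>y. y \<^bold>\<in> a \<and> is_set_of y (\<lambda>z. z \<^bold>\<in> x \<or> z = x)))"
    and separation: "\<exists>c. is_set_of c (\<lambda>x. x \<^bold>\<in> a \<and> sat (\<^bold>\<in>) \<phi> (e(0 := x)))"
    and replacement:
      "(\<And>x y y'. x \<^bold>\<in> a \<Longrightarrow> sat (\<^bold>\<in>) \<phi> (e(0 := x, 1 := y)) \<Longrightarrow>
          sat (\<^bold>\<in>) \<phi> (e(0 := x, 1 := y')) \<Longrightarrow> y = y') \<Longrightarrow>
       \<exists>c. is_set_of c (\<lambda>y. \<exists>x. x \<^bold>\<in> a \<and> sat (\<^bold>\<in>) \<phi> (e(0 := x, 1 := y)))"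
begin

lemma not_ketonen_less:
  assumes "ordinal \<delta>"
  shows "\<not> ketonen_less \<delta> F G"
proof
  assume K: "ketonen_less \<delta> F G"
  then have "filter_on \<delta> F"
    by (simp add: ketonen_less_def wf_filter_def)
  then have "nonempty \<delta>"
    using filter_onD by blast
  then obtain z where z: "z \<^bold>\<in> \<delta>" "\<not> (\<exists>w. w \<^bold>\<in> z \<and> w \<^bold>\<in> \<delta>)"
    by (auto dest: foundation)
  have "\<forall>x. x \<^bold>\<in> \<delta> \<longrightarrow> x \<^bold>\<subseteq> \<delta>"
    using assms unfolding ordinal_def by (rule conjunct1)
  then have "z \<^bold>\<subseteq> \<delta>"
    using z(1) by blast
  then have "\<not> nonempty z"
    using z(2) by (auto simp: subset_def nonempty_def)
  moreover obtain s where fn: "function_on s \<delta>"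
      and s: "\<And>\<alpha> H. \<alpha> \<^bold>\<in> \<delta> \<Longrightarrow> maps_to s \<alpha> H \<Longrightarrow> wf_filter_at \<delta> \<alpha> H"
    using K by (auto simp: ketonen_less_def)
  obtain H where "maps_to s z H"
    using function_onD[OF fn z(1)] by blast
  then have "filter_on \<delta> H" "z \<^bold>\<in> H"
    using s[OF z(1)] by (simp_all add: wf_filter_at_def wf_filter_def)
  then have "nonempty z"
    by (rule filter_onD(2))
  ultimately show False
    by contradiction
qed

end

end

theory Submission
  imports Defs
begin

text \<open>
  The order on \<open>\<F>(\<delta>,\<alpha>)\<close> is wellfounded by induction on \<open>\<alpha>\<close>. Suppose that \<open>S \<subseteq> \<F>(\<delta>,\<alpha>)\<close> has no minimal
  element, and fix \<open>G \<in> S\<close>. Consider all sequences \<open>s\<close> witnessing \<open>F \<lhd> G\<close> for some \<open>F \<in> S\<close>. By the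
  induction hypothesis \<open>s\<^sub>x\<close> has a Ketonen rank in \<open>\<F>(\<delta>,x)\<close> for \<open>G\<close>-almost all \<open>x < \<alpha>\<close>, and as \<open>G\<close> is a
  wellfounded filter, some \<open>s\<close> minimises the function \<open>x \<mapsto> rank(s\<^sub>x)\<close> modulo \<open>G\<close>. If \<open>s\<close> witnesses
  \<open>F \<lhd> G\<close> and \<open>t\<close> witnesses \<open>E \<lhd> F\<close> with \<open>E \<in> S\<close>, then \<open>x \<mapsto> s\<^sub>x-lim t\<close> witnesses \<open>E \<lhd> G\<close> and is
  below \<open>s\<close> at \<open>G\<close>-almost all \<open>x\<close>, a contradiction. That \<open>s\<^sub>x-lim t\<close> is again wellfounded is seen in
  the same way, comparing ranks in the reduced powers modulo \<open>t\<^sub>y\<close>.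
\<close>

subsection \<open>Definability\<close>

primrec rename_fm :: "(nat \<Rightarrow> nat) \<Rightarrow> fm \<Rightarrow> fm" where
  "rename_fm r (FMem i j) = FMem (r i) (r j)"
| "rename_fm r (FEq i j) = FEq (r i) (r j)"
| "rename_fm r (FNot p) = FNot (rename_fm r p)"
| "rename_fm r (FAnd p q) = FAnd (rename_fm r p) (rename_fm r q)"
| "rename_fm r (FEx i p) = FEx (r i) (rename_fm r p)"

text \<open>Bound variables are renamed too. Injectivity of \<open>r\<close> keeps the update at
  \<open>r i\<close> away from the image of every other variable, so nothing is captured.\<close>

lemma sat_rename_fm:
  assumes "inj r"
  shows "sat mem (rename_fm r p) e \<longleftrightarrow> sat mem p (\<lambda>n. e (r n))"
proof (induction p arbitrary: e)
  case (FEx i p)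
  have "(\<lambda>n. (e(r i := x)) (r n)) = (\<lambda>n. e (r n))(i := x)" for x
    using assms by (auto simp: fun_eq_iff inj_eq)
  then show ?case by (simp add: FEx)
qed auto

text \<open>\<open>sat\<close> reads a single environment. Variables go to the even positions and
  parameters to the odd ones, which leaves infinitely many slots for both when predicates are
  combined.\<close>

definition interleave :: "(nat \<Rightarrow> 'a) \<Rightarrow> (nat \<Rightarrow> 'a) \<Rightarrow> nat \<Rightarrow> 'a" where
  "interleave e c n = (if even n then e (n div 2) else c (n div 2))"

lemma interleave_simps [simp]:
  "interleave e c (2 * n) = e n" "interleave e c (Suc (2 * n)) = c n"
  by (simp_all add: interleave_def)

lemma interleave_upd: "interleave (e(i := x)) c = (interleave e c)(2 * i := x)"
proof
  show "interleave (e(i := x)) c n = ((interleave e c)(2 * i := x)) n" for n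
  proof (cases "even n")
    case True
    then obtain k where "n = 2 * k" by (elim evenE)
    then show ?thesis by (simp only: interleave_simps fun_upd_apply) simp
  next
    case False
    then have "n \<noteq> 2 * i" by auto
    then show ?thesis using False by (simp add: interleave_def)
  qed
qed

text \<open>Two predicates with parameter sequences \<open>c\<close> and \<open>d\<close> must share
  one sequence before they can be conjoined. This renaming reads \<open>c\<close> out of
  \<open>interleave c d\<close>; \<open>interleave_right\<close> reads out \<open>d\<close>.\<close>

lemma interleave_left:
  obtains r :: "nat \<Rightarrow> nat" where "inj r"
    "\<And>e c d :: nat \<Rightarrow> 'a. (\<lambda>n. interleave e (interleave c d) (r n)) = interleave e c"
proof
  \<comment> \<open>Parameter \<open>k\<close>, at position \<open>n = 2 * k + 1\<close>, becomes
    parameter \<open>2 * k\<close> of the merged sequence, at position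
    \<open>4 * k + 1\<close>.\<close>
  let ?r = "\<lambda>n::nat. if even n then n else 2 * n - 1"
  show "inj ?r"
    by (rule injI) (auto split: if_splits elim!: oddE)
  show "(\<lambda>n. interleave e (interleave c d) (?r n)) = interleave e c" for e c d :: "nat \<Rightarrow> 'a"
  proof
    show "interleave e (interleave c d) (?r n) = interleave e c n" for n
    proof (cases "even n")
      case False
      then obtain k where "n = 2 * k + 1" by (elim oddE)
      then have "?r n = Suc (2 * (2 * k))" "n = Suc (2 * k)" by auto
      then show ?thesis by (simp only: interleave_simps)
    qed (simp add: interleave_def)
  qed
qed

lemma interleave_right:
  obtains r :: "nat \<Rightarrow> nat" where "inj r"
    "\<And>e c d :: nat \<Rightarrow> 'a. (\<lambda>n. interleave e (interleave c d) (r n)) = interleave e d"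
proof
  \<comment> \<open>Here parameter \<open>k\<close> becomes parameter \<open>2 * k + 1\<close> of
    the merged sequence, at position \<open>4 * k + 3\<close>.\<close>
  let ?r = "\<lambda>n::nat. if even n then n else 2 * n + 1"
  show "inj ?r"
    by (rule injI) (auto split: if_splits elim!: oddE)
  show "(\<lambda>n. interleave e (interleave c d) (?r n)) = interleave e d" for e c d :: "nat \<Rightarrow> 'a"
  proof
    show "interleave e (interleave c d) (?r n) = interleave e d n" for n
    proof (cases "even n")
      case False
      then obtain k where "n = 2 * k + 1" by (elim oddE)
      then have "?r n = Suc (2 * Suc (2 * k))" "n = Suc (2 * k)" by auto
      then show ?thesis by (simp only: interleave_simps)
    qed (simp add: interleave_def)
  qed
qed

text \<open>Serves the existential quantifier: de Bruijn variable 0 moves to position 1, the slot of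
  the dummy parameter \<open>u\<close>. The other variables drop by one index, and the proper
  parameters rise by one.\<close>

lemma interleave_shift:
  obtains r :: "nat \<Rightarrow> nat" where "inj r"
    "\<And>(e :: nat \<Rightarrow> 'a) c x u.
       (\<lambda>n. ((interleave e (case_nat u c))(1 := x)) (r n)) = interleave (case_nat x e) c"
proof
  let ?r = "\<lambda>n::nat. if n = 0 then 1 else if even n then n - 2 else n + 2"
  show "inj ?r"
    by (rule injI) (simp split: if_splits; presburger)
  show "(\<lambda>n. ((interleave e (case_nat u c))(1 := x)) (?r n)) = interleave (case_nat x e) c"
    for e c :: "nat \<Rightarrow> 'a" and x u
  proof
    fix n
    consider "n = 0" | k where "n = 2 * Suc k" | k where "n = Suc (2 * k)"
      by (metis evenE oddE Suc_eq_plus1 not0_implies_Suc mult_0_right)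
    then show "((interleave e (case_nat u c))(1 := x)) (?r n) = interleave (case_nat x e) c n"
    proof cases
      case (2 k)
      then have "?r n = 2 * k" by simp
      then show ?thesis by (simp only: 2 interleave_simps) (simp add: interleave_def)
    next
      case (3 k)
      then have "?r n = Suc (2 * Suc k)" by simp
      then show ?thesis by (simp only: 3) (simp add: interleave_def)
    qed (simp add: interleave_def)
  qed
qed

context set_structure
begin

text \<open>Environments assign values to de Bruijn indices; parameters from the structure are allowed
  and interpret the odd variables of the formula. \<open>simple_term\<close> captures variables and parameters.\<close>

definition definable :: "((nat \<Rightarrow> 'v) \<Rightarrow> bool) \<Rightarrow> bool" where
  "definable P \<longleftrightarrow> (\<exists>\<phi> c. \<forall>e. P e \<longleftrightarrow> sat (\<^bold>\<in>) \<phi> (interleave e c))"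

definition simple_term :: "((nat \<Rightarrow> 'v) \<Rightarrow> 'v) \<Rightarrow> bool" where
  "simple_term t \<longleftrightarrow> (\<exists>n. t = (\<lambda>e. e n)) \<or> (\<exists>c. t = (\<lambda>_. c))"

text \<open>Admitting every substitution of variables and parameters lets such a relation be used as
  an atom under any quantifiers, also with equal arguments.\<close>

definition definable2 :: "('v \<Rightarrow> 'v \<Rightarrow> bool) \<Rightarrow> bool" where
  "definable2 R \<longleftrightarrow>
     (\<forall>t u. simple_term t \<longrightarrow> simple_term u \<longrightarrow> definable (\<lambda>e. R (t e) (u e)))"

definition definable3 :: "('v \<Rightarrow> 'v \<Rightarrow> 'v \<Rightarrow> bool) \<Rightarrow> bool" where
  "definable3 R \<longleftrightarrow>
     (\<forall>t u v. simple_term t \<longrightarrow> simple_term u \<longrightarrow> simple_term v \<longrightarrow>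
        definable (\<lambda>e. R (t e) (u e) (v e)))"

lemma simple_term_var: "simple_term (\<lambda>e. e n)"
  and simple_term_const: "simple_term (\<lambda>e. c)"
  by (auto simp: simple_term_def)

lemma simple_term_shift: "simple_term t \<Longrightarrow> simple_term (\<lambda>e. t (\<lambda>n. e (Suc n)))"
  by (auto simp: simple_term_def)

lemma simple_term_interleave:
  assumes "simple_term t"
  obtains i c where "t = (\<lambda>e. interleave e c i)"
  using assms unfolding simple_term_def
proof (elim disjE exE)
  fix n assume "t = (\<lambda>e. e n)"
  then show thesis by (intro that[of _ "2 * n"]) simp
next
  fix c assume "t = (\<lambda>_. c)"
  then show thesis by (intro that[of "\<lambda>_. c" 1]) (simp add: interleave_def)
qed

lemma simple_terms_interleave:
  assumes "simple_term t" "simple_term u"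
  obtains i j c where "t = (\<lambda>e. interleave e c i)" "u = (\<lambda>e. interleave e c j)"
proof -
  obtain i c where t: "t = (\<lambda>e. interleave e c i)"
    using assms(1) by (rule simple_term_interleave)
  obtain j d where u: "u = (\<lambda>e. interleave e d j)"
    using assms(2) by (rule simple_term_interleave)
  obtain r :: "nat \<Rightarrow> nat" where
    r: "\<And>e c d :: nat \<Rightarrow> 'v. (\<lambda>n. interleave e (interleave c d) (r n)) = interleave e c"
    by (rule interleave_left) (rule that)
  obtain r' :: "nat \<Rightarrow> nat" where
    r': "\<And>e c d :: nat \<Rightarrow> 'v. (\<lambda>n. interleave e (interleave c d) (r' n)) = interleave e d"
    by (rule interleave_right) (rule that)
  show thesis
    by (rule that[of "interleave c d" "r i" "r' j"])
      (simp_all add: t u fun_cong[OF r] fun_cong[OF r'])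
qed

section \<open>Closure of definability under the first-order connectives\<close>

lemma definable_mem:
  assumes "simple_term t" "simple_term u"
  shows "definable (\<lambda>e. t e \<^bold>\<in> u e)"
proof -
  obtain i j c where "t = (\<lambda>e. interleave e c i)" "u = (\<lambda>e. interleave e c j)"
    using assms by (rule simple_terms_interleave)
  then show ?thesis
    unfolding definable_def by (intro exI[of _ "FMem i j"] exI[of _ c]) simp
qed

lemma definable_eq:
  assumes "simple_term t" "simple_term u"
  shows "definable (\<lambda>e. t e = u e)"
proof -
  obtain i j c where "t = (\<lambda>e. interleave e c i)" "u = (\<lambda>e. interleave e c j)"
    using assms by (rule simple_terms_interleave)
  then show ?thesis
    unfolding definable_def by (intro exI[of _ "FEq i j"] exI[of _ c]) simp
qed

lemma definable_not:
  assumes "definable P"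
  shows "definable (\<lambda>e. \<not> P e)"
proof -
  obtain \<phi> c where "\<And>e. P e \<longleftrightarrow> sat (\<^bold>\<in>) \<phi> (interleave e c)"
    using assms by (auto simp: definable_def)
  then show ?thesis
    unfolding definable_def by (intro exI[of _ "FNot \<phi>"] exI[of _ c]) simp
qed

lemma definable_and:
  assumes "definable P" "definable Q"
  shows "definable (\<lambda>e. P e \<and> Q e)"
proof -
  obtain \<phi> c where P: "\<And>e. P e \<longleftrightarrow> sat (\<^bold>\<in>) \<phi> (interleave e c)"
    using assms(1) by (auto simp: definable_def)
  obtain \<psi> d where Q: "\<And>e. Q e \<longleftrightarrow> sat (\<^bold>\<in>) \<psi> (interleave e d)"
    using assms(2) by (auto simp: definable_def)
  obtain r :: "nat \<Rightarrow> nat" where r: "inj r"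
    "\<And>e c d :: nat \<Rightarrow> 'v. (\<lambda>n. interleave e (interleave c d) (r n)) = interleave e c"
    by (rule interleave_left) (rule that)
  obtain r' :: "nat \<Rightarrow> nat" where r': "inj r'"
    "\<And>e c d :: nat \<Rightarrow> 'v. (\<lambda>n. interleave e (interleave c d) (r' n)) = interleave e d"
    by (rule interleave_right) (rule that)
  show ?thesis
    unfolding definable_def
    by (intro exI[of _ "FAnd (rename_fm r \<phi>) (rename_fm r' \<psi>)"] exI[of _ "interleave c d"])
      (simp add: P Q sat_rename_fm[OF r(1)] sat_rename_fm[OF r'(1)] r(2) r'(2))
qed

text \<open>In the premise the bound variable has de Bruijn index 0 and the others are shifted up.
  The formula built here quantifies position 1, a parameter slot reserved for this purpose.\<close>

lemma definable_ex:
  assumes "definable (\<lambda>e. P (e 0) (\<lambda>n. e (Suc n)))"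
  shows "definable (\<lambda>e. \<exists>x. P x e)"
proof -
  obtain \<phi> c where P: "\<And>e. P (e 0) (\<lambda>n. e (Suc n)) \<longleftrightarrow> sat (\<^bold>\<in>) \<phi> (interleave e c)"
    using assms by (auto simp: definable_def)
  have P': "P x e \<longleftrightarrow> sat (\<^bold>\<in>) \<phi> (interleave (case_nat x e) c)" for x e
    using P[of "case_nat x e"] by simp
  obtain r :: "nat \<Rightarrow> nat" where r: "inj r" "\<And>(e :: nat \<Rightarrow> 'v) c x u.
     (\<lambda>n. ((interleave e (case_nat u c))(1 := x)) (r n)) = interleave (case_nat x e) c"
    by (rule interleave_shift) (rule that)
  show ?thesis
    unfolding definable_def
    \<comment> \<open>\<open>undefined\<close> only fills the parameter slot at position 1, which
      the quantifier overwrites.\<close>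
    by (intro exI[of _ "FEx 1 (rename_fm r \<phi>)"] exI[of _ "case_nat undefined c"])
      (simp only: sat.simps sat_rename_fm[OF r(1)] r(2) P' simp_thms)
qed

lemma definable_or:
  assumes "definable P" "definable Q"
  shows "definable (\<lambda>e. P e \<or> Q e)"
proof -
  have "definable (\<lambda>e. \<not> (\<not> P e \<and> \<not> Q e))"
    by (intro definable_not definable_and assms)
  then show ?thesis by simp
qed

lemma definable_imp:
  assumes "definable P" "definable Q"
  shows "definable (\<lambda>e. P e \<longrightarrow> Q e)"
proof -
  have "definable (\<lambda>e. \<not> P e \<or> Q e)"
    by (intro definable_or definable_not assms)
  then show ?thesis by simp
qed

lemma definable_iff:
  assumes "definable P" "definable Q"
  shows "definable (\<lambda>e. P e \<longleftrightarrow> Q e)"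
proof -
  have "definable (\<lambda>e. (P e \<longrightarrow> Q e) \<and> (Q e \<longrightarrow> P e))"
    by (intro definable_and definable_imp assms)
  then show ?thesis by (simp only: iff_conv_conj_imp)
qed

lemma definable_all:
  assumes "definable (\<lambda>e. P (e 0) (\<lambda>n. e (Suc n)))"
  shows "definable (\<lambda>e. \<forall>x. P x e)"
proof -
  have "definable (\<lambda>e. \<not> (\<exists>x. \<not> P x e))"
    by (intro definable_not definable_ex assms)
  then show ?thesis by simp
qed

lemma definable2D:
  "definable2 R \<Longrightarrow> simple_term t \<Longrightarrow> simple_term u \<Longrightarrow> definable (\<lambda>e. R (t e) (u e))"
  by (simp add: definable2_def)

lemma definable3D:
  "definable3 R \<Longrightarrow> simple_term t \<Longrightarrow> simple_term u \<Longrightarrow> simple_term v \<Longrightarrow>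
    definable (\<lambda>e. R (t e) (u e) (v e))"
  by (simp add: definable3_def)

lemma definable2I:
  "(\<And>t u. simple_term t \<Longrightarrow> simple_term u \<Longrightarrow> definable (\<lambda>e. R (t e) (u e))) \<Longrightarrow> definable2 R"
  by (simp add: definable2_def)

lemma definable3I:
  "(\<And>t u v. simple_term t \<Longrightarrow> simple_term u \<Longrightarrow> simple_term v \<Longrightarrow>
     definable (\<lambda>e. R (t e) (u e) (v e))) \<Longrightarrow> definable3 R"
  by (simp add: definable3_def)

text \<open>Used as introduction rules, these make a definability proof follow the syntax of the
  unfolded notion; below each quantifier \<open>simple_term_shift\<close> shows that the shifted
  terms are still simple.\<close>

lemmas definable_logic =
  simple_term_const simple_term_var simple_term_shift
  definable_mem definable_eq definable_not definable_and definable_or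
  definable_imp definable_iff definable_ex definable_all

section \<open>Definability of the set-theoretic notions\<close>

lemma definable_is_set_of:
  assumes "simple_term a" "definable (\<lambda>e. P (\<lambda>n. e (Suc n)) (e 0))"
  shows "definable (\<lambda>e. is_set_of (a e) (P e))"
  unfolding is_set_of_def by (intro definable_logic assms)

lemma definable_subset:
  "simple_term a \<Longrightarrow> simple_term b \<Longrightarrow> definable (\<lambda>e. a e \<^bold>\<subseteq> b e)"
  unfolding subset_def by (intro definable_logic)

lemma definable_nonempty: "simple_term a \<Longrightarrow> definable (\<lambda>e. nonempty (a e))"
  unfolding nonempty_def by (intro definable_logic)

lemma definable_is_pair:
  "simple_term p \<Longrightarrow> simple_term x \<Longrightarrow> simple_term y \<Longrightarrow> definable (\<lambda>e. is_pair (p e) (x e) (y e))"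
  unfolding is_pair_def by (intro definable_logic definable_is_set_of)

lemma definable_maps_to:
  "simple_term f \<Longrightarrow> simple_term x \<Longrightarrow> simple_term y \<Longrightarrow> definable (\<lambda>e. maps_to (f e) (x e) (y e))"
  unfolding maps_to_def by (intro definable_logic definable_is_pair)

lemmas definable_intros =
  definable_logic definable_is_set_of definable_subset definable_nonempty definable_is_pair
  definable_maps_to

lemma definable_function_on:
  "simple_term f \<Longrightarrow> simple_term X \<Longrightarrow> definable (\<lambda>e. function_on (f e) (X e))"
  unfolding function_on_def Ex1_def by (intro definable_intros)

lemma definable_function_to:
  "simple_term f \<Longrightarrow> simple_term X \<Longrightarrow> simple_term Y \<Longrightarrow>
    definable (\<lambda>e. function_to (f e) (X e) (Y e))"
  unfolding function_to_def by (intro definable_intros definable_function_on)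

lemma definable_ordinal: "simple_term a \<Longrightarrow> definable (\<lambda>e. ordinal (a e))"
  unfolding ordinal_def wellfounded_on_def by (intro definable_intros)

lemma definable_filter_on:
  "simple_term X \<Longrightarrow> simple_term F \<Longrightarrow> definable (\<lambda>e. filter_on (X e) (F e))"
  unfolding filter_on_def by (intro definable_intros)

lemma definable_less_mod:
  "simple_term X \<Longrightarrow> simple_term F \<Longrightarrow> simple_term f \<Longrightarrow> simple_term g \<Longrightarrow>
    definable (\<lambda>e. less_mod (X e) (F e) (f e) (g e))"
  unfolding less_mod_def almost_all_def by (intro definable_intros)

lemma definable_eq_mod:
  "simple_term X \<Longrightarrow> simple_term F \<Longrightarrow> simple_term f \<Longrightarrow> simple_term g \<Longrightarrow>
    definable (\<lambda>e. eq_mod (X e) (F e) (f e) (g e))"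
  unfolding eq_mod_def almost_all_def by (intro definable_intros)

lemma definable_in_reduced_power:
  "simple_term \<gamma> \<Longrightarrow> simple_term X \<Longrightarrow> simple_term F \<Longrightarrow> simple_term c \<Longrightarrow>
    definable (\<lambda>e. in_reduced_power (\<gamma> e) (X e) (F e) (c e))"
  unfolding in_reduced_power_def
  by (intro definable_intros definable_function_to definable_eq_mod)

lemma definable_reduced_power_less:
  "simple_term X \<Longrightarrow> simple_term F \<Longrightarrow> simple_term c \<Longrightarrow> simple_term d \<Longrightarrow>
    definable (\<lambda>e. reduced_power_less (X e) (F e) (c e) (d e))"
  unfolding reduced_power_less_def by (intro definable_intros definable_less_mod)

lemma definable_wf_filter:
  "simple_term X \<Longrightarrow> simple_term F \<Longrightarrow> definable (\<lambda>e. wf_filter (X e) (F e))"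
  unfolding wf_filter_def wellfounded_on_def
  by (intro definable_intros definable_filter_on definable_ordinal definable_in_reduced_power
      definable_reduced_power_less)

lemma definable_wf_filter_at:
  "simple_term \<delta> \<Longrightarrow> simple_term \<alpha> \<Longrightarrow> simple_term F \<Longrightarrow>
    definable (\<lambda>e. wf_filter_at (\<delta> e) (\<alpha> e) (F e))"
  unfolding wf_filter_at_def by (intro definable_intros definable_wf_filter)

lemma definable_is_filter_limit:
  "simple_term \<delta> \<Longrightarrow> simple_term G \<Longrightarrow> simple_term s \<Longrightarrow> simple_term L \<Longrightarrow>
    definable (\<lambda>e. is_filter_limit (\<delta> e) (G e) (s e) (L e))"
  unfolding is_filter_limit_def almost_all_def by (intro definable_intros)

lemma definable_ketonen_less_ae:
  "simple_term \<delta> \<Longrightarrow> simple_term F \<Longrightarrow> simple_term G \<Longrightarrow>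
    definable (\<lambda>e. ketonen_less_ae (\<delta> e) (F e) (G e))"
  unfolding ketonen_less_ae_def almost_all_def
  by (intro definable_intros definable_wf_filter definable_wf_filter_at definable_filter_on
      definable_function_on definable_is_filter_limit)

lemmas definable_set_theory =
  definable_function_on definable_function_to definable_ordinal definable_filter_on
  definable_less_mod definable_eq_mod definable_wf_filter definable_wf_filter_at
  definable_is_filter_limit definable_ketonen_less_ae

text \<open>Isolates the sequence hidden in \<open>ketonen_less_ae\<close>, because the main
  argument minimises over witnessing sequences.\<close>

definition ketonen_witness :: "'v \<Rightarrow> 'v \<Rightarrow> 'v \<Rightarrow> 'v \<Rightarrow> bool" where
  "ketonen_witness \<delta> F G s \<longleftrightarrow>
     function_on s \<delta> \<and>
     (\<forall>\<alpha> H. \<alpha> \<^bold>\<in> \<delta> \<and> maps_to s \<alpha> H \<longrightarrow> filter_on \<delta> H) \<and>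
     almost_all \<delta> G (\<lambda>\<alpha>. \<exists>H. maps_to s \<alpha> H \<and> wf_filter_at \<delta> \<alpha> H) \<and>
     (\<exists>L. is_filter_limit \<delta> G s L \<and> F \<^bold>\<subseteq> L)"

lemma ketonen_less_ae_iff:
  "ketonen_less_ae \<delta> F G \<longleftrightarrow> wf_filter \<delta> F \<and> wf_filter \<delta> G \<and> (\<exists>s. ketonen_witness \<delta> F G s)"
  unfolding ketonen_less_ae_def ketonen_witness_def by (rule refl)

lemma definable_ketonen_witness:
  "simple_term \<delta> \<Longrightarrow> simple_term F \<Longrightarrow> simple_term G \<Longrightarrow> simple_term s \<Longrightarrow>
    definable (\<lambda>e. ketonen_witness (\<delta> e) (F e) (G e) (s e))"
  unfolding ketonen_witness_def almost_all_def
  by (intro definable_intros definable_set_theory)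

text \<open>Both values at \<open>x\<close> are required to satisfy \<open>wf_filter_at\<close>,
  since the induction hypothesis at \<open>x\<close> speaks of such filters only.\<close>

definition pointwise_ketonen_less :: "'v \<Rightarrow> 'v \<Rightarrow> 'v \<Rightarrow> 'v \<Rightarrow> bool" where
  "pointwise_ketonen_less \<delta> x s' s \<longleftrightarrow>
     (\<exists>H' H. maps_to s' x H' \<and> maps_to s x H \<and> wf_filter_at \<delta> x H' \<and> wf_filter_at \<delta> x H \<and>
       ketonen_less_ae \<delta> H' H)"

lemma definable_pointwise_ketonen_less:
  "simple_term \<delta> \<Longrightarrow> simple_term x \<Longrightarrow> simple_term s' \<Longrightarrow> simple_term s \<Longrightarrow>
    definable (\<lambda>e. pointwise_ketonen_less (\<delta> e) (x e) (s' e) (s e))"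
  unfolding pointwise_ketonen_less_def by (intro definable_intros definable_set_theory)

end

context ZF_model
begin

subsection \<open>Sets and functions\<close>

text \<open>Variable 0 stays at position 0 of an interleaving, so the update made by the Separation
  scheme is the binding of index 0, and the parameters are carried along in
  \<open>E\<close>.\<close>

lemma definable_separation:
  assumes "definable (\<lambda>e. P (e 0))"
  obtains c where "\<And>x. x \<^bold>\<in> c \<longleftrightarrow> x \<^bold>\<in> a \<and> P x"
proof -
  obtain \<phi> c where P: "\<And>e. P (e 0) \<longleftrightarrow> sat (\<^bold>\<in>) \<phi> (interleave e c)"
    using assms by (auto simp: definable_def)
  define E where "E = interleave (\<lambda>_. a) c"
  have upd: "interleave ((\<lambda>_. a)(0 := x)) c = E(0 := x)" for x
    by (simp add: E_def interleave_upd)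
  have "P x \<longleftrightarrow> sat (\<^bold>\<in>) \<phi> (E(0 := x))" for x
    using P[of "(\<lambda>_. a)(0 := x)"] by (simp add: upd)
  moreover obtain d where "is_set_of d (\<lambda>x. x \<^bold>\<in> a \<and> sat (\<^bold>\<in>) \<phi> (E(0 := x)))"
    using separation by blast
  ultimately show thesis
    by (intro that[of d]) (simp add: is_set_of_def)
qed

lemma definable_replacement:
  assumes "definable2 P"
    and "\<And>x y y'. x \<^bold>\<in> a \<Longrightarrow> P x y \<Longrightarrow> P x y' \<Longrightarrow> y = y'"
  obtains c where "\<And>y. y \<^bold>\<in> c \<longleftrightarrow> (\<exists>x. x \<^bold>\<in> a \<and> P x y)"
proof -
  have "definable (\<lambda>e. P (e 0) (e 1))"
    by (rule definable2D[OF assms(1)]) (intro definable_intros)+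
  then obtain \<phi> c where P: "\<And>e. P (e 0) (e 1) \<longleftrightarrow> sat (\<^bold>\<in>) \<phi> (interleave e c)"
    by (auto simp: definable_def)
  \<comment> \<open>The scheme uses variables 0 and 1, whereas in an interleaving the second
    variable sits at position 2 and position 1 holds a parameter. The formula is therefore renamed
    by swapping 1 and 2; \<open>E\<close> is permuted likewise, so that the two swaps
    cancel.\<close>
  let ?r = "\<lambda>n::nat. if n = 1 then 2 else if n = 2 then 1 else n"
  have r: "inj ?r"
    by (rule inj_on_inverseI[of _ ?r]) simp
  let ?I = "interleave (\<lambda>_. a) c"
  define E where "E n = ?I (?r n)" for n
  have "(\<lambda>n. (E(0 := x, 1 := y)) (?r n)) = ?I(2 * 0 := x, 2 * 1 := y)" for x y
    by (simp add: fun_eq_iff E_def)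
  then have upd: "(\<lambda>n. (E(0 := x, 1 := y)) (?r n)) = interleave ((\<lambda>_. a)(0 := x, 1 := y)) c" for x y
    by (simp only: interleave_upd)
  have *: "sat (\<^bold>\<in>) (rename_fm ?r \<phi>) (E(0 := x, 1 := y)) \<longleftrightarrow> P x y" for x y
    using P[of "(\<lambda>_. a)(0 := x, 1 := y)"] by (simp only: sat_rename_fm[OF r] upd) simp
  have "\<exists>d. is_set_of d (\<lambda>y. \<exists>x. x \<^bold>\<in> a \<and> sat (\<^bold>\<in>) (rename_fm ?r \<phi>) (E(0 := x, 1 := y)))"
    by (rule replacement, unfold *) (rule assms(2))
  then obtain d where "is_set_of d (\<lambda>y. \<exists>x. x \<^bold>\<in> a \<and> P x y)"
    unfolding * by (rule exE)
  then show thesis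
    by (intro that[of d]) (simp add: is_set_of_def)
qed

lemma set_eqI: "(\<And>x. x \<^bold>\<in> a \<longleftrightarrow> x \<^bold>\<in> b) \<Longrightarrow> a = b"
  using extensionality by blast

lemma is_set_of_unique: "is_set_of a P \<Longrightarrow> is_set_of b P \<Longrightarrow> a = b"
  by (rule set_eqI) (simp add: is_set_of_def)

lemma not_mem_self: "\<not> x \<^bold>\<in> x"
proof
  assume x: "x \<^bold>\<in> x"
  obtain s where s: "\<And>z. z \<^bold>\<in> s \<longleftrightarrow> z = x"
    using pairing[of x x] by (auto simp: is_set_of_def)
  then have "nonempty s" by (auto simp: nonempty_def)
  then show False
    using foundation[of s] s x by auto
qed

lemma insert_set:
  obtains c where "\<And>z. z \<^bold>\<in> c \<longleftrightarrow> z \<^bold>\<in> a \<or> z = b"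
proof -
  obtain s where s: "\<And>z. z \<^bold>\<in> s \<longleftrightarrow> z = b"
    using pairing[of b b] by (auto simp: is_set_of_def)
  obtain p where p: "\<And>z. z \<^bold>\<in> p \<longleftrightarrow> z = a \<or> z = s"
    using pairing[of a s] by (auto simp: is_set_of_def)
  obtain u where u: "\<And>z. z \<^bold>\<in> u \<longleftrightarrow> (\<exists>y. y \<^bold>\<in> p \<and> z \<^bold>\<in> y)"
    using union[of p] by (auto simp: is_set_of_def)
  show thesis
    by (rule that[of u]) (auto simp: u p s)
qed

lemma union_set:
  obtains c where "\<And>z. z \<^bold>\<in> c \<longleftrightarrow> (\<exists>y. y \<^bold>\<in> a \<and> z \<^bold>\<in> y)"
  using union[of a] by (auto simp: is_set_of_def)

lemma powerset_set:
  obtains c where "\<And>z. z \<^bold>\<in> c \<longleftrightarrow> z \<^bold>\<subseteq> a"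
  using power_set[of a] by (auto simp: is_set_of_def)

lemma is_pair_ex: "\<exists>p. is_pair p x y"
proof -
  obtain s where s: "\<And>z. z \<^bold>\<in> s \<longleftrightarrow> z = x"
    using pairing[of x x] by (auto simp: is_set_of_def)
  obtain t where t: "\<And>z. z \<^bold>\<in> t \<longleftrightarrow> z = x \<or> z = y"
    using pairing[of x y] by (auto simp: is_set_of_def)
  obtain p where p: "\<And>z. z \<^bold>\<in> p \<longleftrightarrow> z = s \<or> z = t"
    using pairing[of s t] by (auto simp: is_set_of_def)
  have "is_set_of z (\<lambda>w. w = x) \<longleftrightarrow> z = s" "is_set_of z (\<lambda>w. w = x \<or> w = y) \<longleftrightarrow> z = t" for z
    using s t by (auto simp: is_set_of_def intro: set_eqI)
  then have "is_pair p x y"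
    unfolding is_pair_def by (simp add: is_set_of_def[of p] p)
  then show ?thesis ..
qed

lemma is_pair_unique: "is_pair p x y \<Longrightarrow> is_pair q x y \<Longrightarrow> p = q"
  unfolding is_pair_def by (rule is_set_of_unique)

lemma is_pair_inject:
  assumes "is_pair p x y" "is_pair p x' y'"
  shows "x = x' \<and> y = y'"
proof -
  obtain s where s: "\<And>z. z \<^bold>\<in> s \<longleftrightarrow> z = x"
    using pairing[of x x] by (auto simp: is_set_of_def)
  obtain t where t: "\<And>z. z \<^bold>\<in> t \<longleftrightarrow> z = x \<or> z = y"
    using pairing[of x y] by (auto simp: is_set_of_def)
  obtain s' where s': "\<And>z. z \<^bold>\<in> s' \<longleftrightarrow> z = x'"
    using pairing[of x' x'] by (auto simp: is_set_of_def)
  obtain t' where t': "\<And>z. z \<^bold>\<in> t' \<longleftrightarrow> z = x' \<or> z = y'"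
    using pairing[of x' y'] by (auto simp: is_set_of_def)
  have eq: "is_set_of z (\<lambda>w. w = x) \<longleftrightarrow> z = s" "is_set_of z (\<lambda>w. w = x \<or> w = y) \<longleftrightarrow> z = t"
    "is_set_of z (\<lambda>w. w = x') \<longleftrightarrow> z = s'" "is_set_of z (\<lambda>w. w = x' \<or> w = y') \<longleftrightarrow> z = t'" for z
    using s t s' t' by (auto simp: is_set_of_def intro: set_eqI)
  have "z = s \<or> z = t \<longleftrightarrow> z = s' \<or> z = t'" for z
    using assms unfolding is_pair_def is_set_of_def[of p] eq by blast
  then have "s = s' \<and> t = t' \<or> s = t' \<and> t = s'"
    by metis
  then show ?thesis
  proof (elim disjE conjE)
    assume "s = s'" "t = t'"
    then have "x = x'" "\<And>z. z = x \<or> z = y \<longleftrightarrow> z = x' \<or> z = y'"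
      using s s' t t' by blast+
    then show ?thesis by metis
  next
    assume "s = t'" "t = s'"
    then have "\<And>z. z = x \<longleftrightarrow> z = x' \<or> z = y'" "\<And>z. z = x \<or> z = y \<longleftrightarrow> z = x'"
      using s s' t t' by blast+
    then show ?thesis by metis
  qed
qed

text \<open>Kuratowski pairs from \<open>A\<close> and \<open>B\<close> lie in the double power set
  of the union of \<open>A\<close> and \<open>B\<close>, and Separation applies there.\<close>

lemma product_set:
  obtains c where "\<And>p. p \<^bold>\<in> c \<longleftrightarrow> (\<exists>x y. x \<^bold>\<in> A \<and> y \<^bold>\<in> B \<and> is_pair p x y)"
proof -
  obtain q where q: "\<And>z. z \<^bold>\<in> q \<longleftrightarrow> z = A \<or> z = B"
    using pairing[of A B] by (auto simp: is_set_of_def)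
  obtain u where u: "\<And>z. z \<^bold>\<in> u \<longleftrightarrow> (\<exists>y. y \<^bold>\<in> q \<and> z \<^bold>\<in> y)"
    by (rule union_set) (rule that)
  obtain v where v: "\<And>z. z \<^bold>\<in> v \<longleftrightarrow> z \<^bold>\<subseteq> u"
    by (rule powerset_set) (rule that)
  obtain w where w: "\<And>z. z \<^bold>\<in> w \<longleftrightarrow> z \<^bold>\<subseteq> v"
    by (rule powerset_set) (rule that)
  have "definable (\<lambda>e. \<exists>x y. x \<^bold>\<in> A \<and> y \<^bold>\<in> B \<and> is_pair (e 0) x y)"
    by (intro definable_intros)
  then obtain c where c: "\<And>p. p \<^bold>\<in> c \<longleftrightarrow> p \<^bold>\<in> w \<and> (\<exists>x y. x \<^bold>\<in> A \<and> y \<^bold>\<in> B \<and> is_pair p x y)"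
    by (rule definable_separation) (rule that)
  have "p \<^bold>\<in> w" if "x \<^bold>\<in> A" "y \<^bold>\<in> B" "is_pair p x y" for p x y
    using that by (auto simp: w v u q subset_def is_pair_def is_set_of_def)
  then show thesis
    by (intro that[of c]) (auto simp: c)
qed

lemma relation_set:
  assumes "definable2 P"
  obtains f where "\<And>p. p \<^bold>\<in> f \<Longrightarrow> \<exists>x y. x \<^bold>\<in> A \<and> y \<^bold>\<in> B \<and> is_pair p x y"
    and "\<And>x y. maps_to f x y \<longleftrightarrow> x \<^bold>\<in> A \<and> y \<^bold>\<in> B \<and> P x y"
proof -
  obtain c where c: "\<And>p. p \<^bold>\<in> c \<longleftrightarrow> (\<exists>x y. x \<^bold>\<in> A \<and> y \<^bold>\<in> B \<and> is_pair p x y)"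
    by (rule product_set) (rule that)
  have "definable (\<lambda>e. \<exists>x y. is_pair (e 0) x y \<and> P x y)"
    by (intro definable_intros definable2D[OF assms])
  then obtain f where f: "\<And>p. p \<^bold>\<in> f \<longleftrightarrow> p \<^bold>\<in> c \<and> (\<exists>x y. is_pair p x y \<and> P x y)"
    by (rule definable_separation) (rule that)
  have "maps_to f x y \<longleftrightarrow> x \<^bold>\<in> A \<and> y \<^bold>\<in> B \<and> P x y" for x y
  proof
    assume "maps_to f x y"
    then obtain p x1 y1 x2 y2 where p: "is_pair p x y" "x1 \<^bold>\<in> A" "y1 \<^bold>\<in> B" "is_pair p x1 y1"
      "is_pair p x2 y2" "P x2 y2"
      by (auto simp: maps_to_def f c)
    then show "x \<^bold>\<in> A \<and> y \<^bold>\<in> B \<and> P x y"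
      using is_pair_inject[OF p(1,4)] is_pair_inject[OF p(1,5)] by simp
  next
    assume "x \<^bold>\<in> A \<and> y \<^bold>\<in> B \<and> P x y"
    moreover obtain p where "is_pair p x y"
      using is_pair_ex by blast
    ultimately show "maps_to f x y"
      by (auto simp: maps_to_def f c)
  qed
  moreover have "\<exists>x y. x \<^bold>\<in> A \<and> y \<^bold>\<in> B \<and> is_pair p x y" if "p \<^bold>\<in> f" for p
    using that by (simp add: f c)
  ultimately show thesis
    by (intro that)
qed

lemma function_set:
  assumes "definable2 P" "\<And>x. x \<^bold>\<in> A \<Longrightarrow> \<exists>!y. P x y" "\<And>x y. x \<^bold>\<in> A \<Longrightarrow> P x y \<Longrightarrow> y \<^bold>\<in> B"
  obtains f where "function_to f A B" and "\<And>x y. maps_to f x y \<longleftrightarrow> x \<^bold>\<in> A \<and> P x y"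
proof -
  obtain f where f: "\<And>p. p \<^bold>\<in> f \<Longrightarrow> \<exists>x y. x \<^bold>\<in> A \<and> y \<^bold>\<in> B \<and> is_pair p x y"
    "\<And>x y. maps_to f x y \<longleftrightarrow> x \<^bold>\<in> A \<and> y \<^bold>\<in> B \<and> P x y"
    by (rule relation_set[OF assms(1)]) (rule that)
  have *: "maps_to f x y \<longleftrightarrow> x \<^bold>\<in> A \<and> P x y" for x y
    using f(2) assms(3) by blast
  have "\<forall>p. p \<^bold>\<in> f \<longrightarrow> (\<exists>x y. x \<^bold>\<in> A \<and> is_pair p x y)"
    using f(1) by blast
  moreover have "\<forall>x y. maps_to f x y \<longrightarrow> y \<^bold>\<in> B"
    using f(2) by blast
  ultimately have "function_to f A B"
    using assms(2) by (simp add: function_to_def function_on_def *)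
  then show thesis
    using * by (rule that)
qed

lemma function_to_maps_to_unique:
  "function_to f X Y \<Longrightarrow> maps_to f x y \<Longrightarrow> maps_to f x y' \<Longrightarrow> y = y'"
  unfolding function_to_def function_on_def maps_to_def using is_pair_inject by metis

lemma function_on_maps_to_unique:
  "function_on f X \<Longrightarrow> maps_to f x y \<Longrightarrow> maps_to f x y' \<Longrightarrow> y = y'"
  unfolding function_on_def maps_to_def using is_pair_inject by metis

lemma function_on_dom: "function_on f X \<Longrightarrow> maps_to f x y \<Longrightarrow> x \<^bold>\<in> X"
  unfolding function_on_def maps_to_def using is_pair_inject by metis

lemma function_to_subset_product:
  assumes "function_to f X Y" "\<And>p. p \<^bold>\<in> c \<longleftrightarrow> (\<exists>x y. x \<^bold>\<in> X \<and> y \<^bold>\<in> Y \<and> is_pair p x y)"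
  shows "f \<^bold>\<subseteq> c"
  unfolding subset_def
proof (intro allI impI)
  fix p assume p: "p \<^bold>\<in> f"
  then obtain x y where "x \<^bold>\<in> X" "is_pair p x y"
    using assms(1) by (auto simp: function_to_def function_on_def)
  moreover have "y \<^bold>\<in> Y"
    using assms(1) p \<open>is_pair p x y\<close> by (auto simp: function_to_def maps_to_def)
  ultimately show "p \<^bold>\<in> c"
    using assms(2) by blast
qed

lemma function_space:
  obtains c where "\<And>f. f \<^bold>\<in> c \<longleftrightarrow> function_to f X Y"
proof -
  obtain c where c: "\<And>p. p \<^bold>\<in> c \<longleftrightarrow> (\<exists>x y. x \<^bold>\<in> X \<and> y \<^bold>\<in> Y \<and> is_pair p x y)"
    by (rule product_set) (rule that)
  obtain d where d: "\<And>z. z \<^bold>\<in> d \<longleftrightarrow> z \<^bold>\<subseteq> c"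
    by (rule powerset_set) (rule that)
  have "definable (\<lambda>e. function_to (e 0) X Y)"
    by (intro definable_intros definable_set_theory)
  then obtain b where b: "\<And>f. f \<^bold>\<in> b \<longleftrightarrow> f \<^bold>\<in> d \<and> function_to f X Y"
    by (rule definable_separation) (rule that)
  show thesis
    by (rule that[of b]) (use b d function_to_subset_product[OF _ c] in blast)
qed

subsection \<open>Ordinals and ranks\<close>

lemma wellfounded_on_mem: "wellfounded_on P (\<^bold>\<in>)"
  unfolding wellfounded_on_def
proof (intro allI impI, elim conjE)
  fix S assume "nonempty S"
  then show "\<exists>m. m \<^bold>\<in> S \<and> \<not> (\<exists>x. x \<^bold>\<in> S \<and> x \<^bold>\<in> m)"
    using foundation[of S] by blast
qed

text \<open>Foundation supplies the irreflexivity and wellfoundedness clauses of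
  \<open>ordinal\<close>.\<close>

lemma ordinal_iff:
  "ordinal a \<longleftrightarrow> (\<forall>x. x \<^bold>\<in> a \<longrightarrow> x \<^bold>\<subseteq> a) \<and>
     (\<forall>x y z. x \<^bold>\<in> a \<and> y \<^bold>\<in> a \<and> z \<^bold>\<in> a \<and> x \<^bold>\<in> y \<and> y \<^bold>\<in> z \<longrightarrow> x \<^bold>\<in> z) \<and>
     (\<forall>x y. x \<^bold>\<in> a \<and> y \<^bold>\<in> a \<longrightarrow> x \<^bold>\<in> y \<or> x = y \<or> y \<^bold>\<in> x)"
  by (simp add: ordinal_def not_mem_self wellfounded_on_mem)

lemma ordinal_trans: "ordinal a \<Longrightarrow> x \<^bold>\<in> a \<Longrightarrow> y \<^bold>\<in> x \<Longrightarrow> y \<^bold>\<in> a"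
  unfolding ordinal_iff subset_def by blast

lemma ordinal_element:
  assumes a: "ordinal a" and x: "x \<^bold>\<in> a"
  shows "ordinal x"
proof -
  have sub: "\<And>y. y \<^bold>\<in> x \<Longrightarrow> y \<^bold>\<in> a"
    using ordinal_trans[OF assms] .
  have tr: "\<And>x y z. x \<^bold>\<in> a \<Longrightarrow> y \<^bold>\<in> a \<Longrightarrow> z \<^bold>\<in> a \<Longrightarrow> x \<^bold>\<in> y \<Longrightarrow> y \<^bold>\<in> z \<Longrightarrow> x \<^bold>\<in> z"
    and tot: "\<And>x y. x \<^bold>\<in> a \<Longrightarrow> y \<^bold>\<in> a \<Longrightarrow> x \<^bold>\<in> y \<or> x = y \<or> y \<^bold>\<in> x"
    using a unfolding ordinal_iff by blast+
  have "y \<^bold>\<subseteq> x" if "y \<^bold>\<in> x" for y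
    unfolding subset_def using tr sub ordinal_trans[OF a] x that by blast
  moreover have "\<forall>u v w. u \<^bold>\<in> x \<and> v \<^bold>\<in> x \<and> w \<^bold>\<in> x \<and> u \<^bold>\<in> v \<and> v \<^bold>\<in> w \<longrightarrow> u \<^bold>\<in> w"
    using tr sub by blast
  moreover have "\<forall>u v. u \<^bold>\<in> x \<and> v \<^bold>\<in> x \<longrightarrow> u \<^bold>\<in> v \<or> u = v \<or> v \<^bold>\<in> u"
    using tot sub by blast
  ultimately show ?thesis
    unfolding ordinal_iff by blast
qed

text \<open>Foundation gives a minimal element \<open>x\<close> of the difference of
  \<open>b\<close> and \<open>c\<close>, and this \<open>x\<close> is \<open>c\<close>: minimality
  yields one inclusion, linearity of \<open>b\<close> with transitivity of \<open>c\<close> the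
  other.\<close>

lemma transitive_subset_of_ordinal:
  assumes "ordinal b" "c \<^bold>\<subseteq> b" "\<And>x y. x \<^bold>\<in> c \<Longrightarrow> y \<^bold>\<in> x \<Longrightarrow> y \<^bold>\<in> c" "c \<noteq> b"
  shows "c \<^bold>\<in> b"
proof -
  have "definable (\<lambda>e. \<not> e 0 \<^bold>\<in> c)"
    by (intro definable_intros)
  then obtain d where d: "\<And>z. z \<^bold>\<in> d \<longleftrightarrow> z \<^bold>\<in> b \<and> \<not> z \<^bold>\<in> c"
    by (rule definable_separation) (rule that)
  have "nonempty d"
    using assms(2,4) set_eqI[of c b] unfolding nonempty_def d subset_def by blast
  then obtain x where x: "x \<^bold>\<in> b" "\<not> x \<^bold>\<in> c" and min: "\<And>z. z \<^bold>\<in> x \<Longrightarrow> z \<^bold>\<in> b \<Longrightarrow> z \<^bold>\<in> c"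
    using foundation[of d] unfolding d by blast
  have "z \<^bold>\<in> x \<longleftrightarrow> z \<^bold>\<in> c" for z
  proof
    assume "z \<^bold>\<in> x"
    then show "z \<^bold>\<in> c"
      using min ordinal_trans[OF assms(1) x(1)] by blast
  next
    assume z: "z \<^bold>\<in> c"
    then have "z \<^bold>\<in> x \<or> z = x \<or> x \<^bold>\<in> z"
      using assms(1,2) x(1) unfolding ordinal_iff subset_def by blast
    then show "z \<^bold>\<in> x"
      using z x(2) assms(3) by blast
  qed
  then have "c = x"
    by (intro set_eqI) simp
  then show ?thesis
    using x(1) by simp
qed

text \<open>The intersection \<open>c\<close> is transitive, so it equals \<open>a\<close> or
  belongs to \<open>a\<close>, and likewise for \<open>b\<close>. Belonging to both would make
  \<open>c\<close> a member of itself.\<close>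

lemma ordinal_linear:
  assumes "ordinal a" "ordinal b"
  shows "a \<^bold>\<in> b \<or> a = b \<or> b \<^bold>\<in> a"
proof -
  have "definable (\<lambda>e. e 0 \<^bold>\<in> b)"
    by (intro definable_intros)
  then obtain c where c: "\<And>z. z \<^bold>\<in> c \<longleftrightarrow> z \<^bold>\<in> a \<and> z \<^bold>\<in> b"
    by (rule definable_separation) (rule that)
  have sub: "c \<^bold>\<subseteq> a" "c \<^bold>\<subseteq> b"
    by (simp_all add: subset_def c)
  have tr: "\<And>x y. x \<^bold>\<in> c \<Longrightarrow> y \<^bold>\<in> x \<Longrightarrow> y \<^bold>\<in> c"
    using c ordinal_trans assms by blast
  have "c = a \<or> c \<^bold>\<in> a" "c = b \<or> c \<^bold>\<in> b"
    using transitive_subset_of_ordinal[OF assms(1) sub(1)]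
      transitive_subset_of_ordinal[OF assms(2) sub(2)] tr by metis+
  then show ?thesis
    using c not_mem_self by blast
qed

lemma ordinalI:
  assumes "\<And>x y. x \<^bold>\<in> a \<Longrightarrow> y \<^bold>\<in> x \<Longrightarrow> y \<^bold>\<in> a" "\<And>x. x \<^bold>\<in> a \<Longrightarrow> ordinal x"
  shows "ordinal a"
proof -
  have "\<forall>x y z. x \<^bold>\<in> a \<and> y \<^bold>\<in> a \<and> z \<^bold>\<in> a \<and> x \<^bold>\<in> y \<and> y \<^bold>\<in> z \<longrightarrow> x \<^bold>\<in> z"
    using assms(2) ordinal_trans by blast
  moreover have "\<forall>x y. x \<^bold>\<in> a \<and> y \<^bold>\<in> a \<longrightarrow> x \<^bold>\<in> y \<or> x = y \<or> y \<^bold>\<in> x"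
    using assms(2) ordinal_linear by blast
  moreover have "\<forall>x. x \<^bold>\<in> a \<longrightarrow> x \<^bold>\<subseteq> a"
    using assms(1) by (simp add: subset_def)
  ultimately show ?thesis
    unfolding ordinal_iff by blast
qed

text \<open>The successor of the union of \<open>B\<close> serves as \<sigma>.\<close>

lemma ordinal_above:
  assumes "\<And>x. x \<^bold>\<in> B \<Longrightarrow> ordinal x"
  obtains \<sigma> where "ordinal \<sigma>" "\<And>x. x \<^bold>\<in> B \<Longrightarrow> x \<^bold>\<in> \<sigma>"
proof -
  obtain u where u: "\<And>z. z \<^bold>\<in> u \<longleftrightarrow> (\<exists>y. y \<^bold>\<in> B \<and> z \<^bold>\<in> y)"
    by (rule union_set) (rule that)
  have ou: "ordinal u"
    by (rule ordinalI) (use u assms ordinal_trans ordinal_element in blast)+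
  obtain v where v: "\<And>z. z \<^bold>\<in> v \<longleftrightarrow> z \<^bold>\<in> u \<or> z = u"
    by (rule insert_set) (rule that)
  have "ordinal v"
    by (rule ordinalI) (use v ou ordinal_trans ordinal_element in blast)+
  moreover have "x \<^bold>\<in> v" if "x \<^bold>\<in> B" for x
    using ordinal_linear[OF assms[OF that] ou] that u v not_mem_self by blast
  ultimately show thesis
    by (rule that)
qed

text \<open>\<open>P\<close> may hold of a proper class, so Foundation is applied to the part of it
  inside the successor of \<beta>.\<close>

lemma least_ordinal:
  assumes "definable (\<lambda>e. P (e 0))" "ordinal \<beta>" "P \<beta>"
  obtains \<mu> where "ordinal \<mu>" "P \<mu>" "\<And>\<xi>. ordinal \<xi> \<Longrightarrow> P \<xi> \<Longrightarrow> \<mu> \<^bold>\<in> \<xi> \<or> \<mu> = \<xi>"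
proof -
  obtain b where b: "\<And>z. z \<^bold>\<in> b \<longleftrightarrow> z \<^bold>\<in> \<beta> \<or> z = \<beta>"
    by (rule insert_set) (rule that)
  obtain d where d: "\<And>z. z \<^bold>\<in> d \<longleftrightarrow> z \<^bold>\<in> b \<and> P z"
    by (rule definable_separation[OF assms(1)]) (rule that)
  have "nonempty d"
    using assms(3) by (auto simp: nonempty_def d b)
  then obtain m where m: "m \<^bold>\<in> d" and min: "\<And>z. z \<^bold>\<in> m \<Longrightarrow> \<not> z \<^bold>\<in> d"
    using foundation[of d] by blast
  have om: "ordinal m"
    using m d b assms(2) ordinal_element by blast
  have "m \<^bold>\<in> \<xi> \<or> m = \<xi>" if "ordinal \<xi>" "P \<xi>" for \<xi>
    using ordinal_linear[OF om that(1)] min[of \<xi>] that(2) m d b ordinal_trans[OF assms(2)] by blast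
  then show thesis
    using that om m d by blast
qed

text \<open>The rank of \<open>a\<close> is the least value at \<open>a\<close> of any attempt. Attempts need be neither functions nor
  unique, so that no recursion theorem is required.\<close>

lemma rank_function:
  assumes R: "definable2 R" and wf: "wellfounded_on (\<lambda>x. x \<^bold>\<in> A) R"
  obtains \<gamma> \<rho> where "ordinal \<gamma>" "function_to \<rho> A \<gamma>"
    "\<And>x y \<xi> \<eta>. x \<^bold>\<in> A \<Longrightarrow> R x y \<Longrightarrow> maps_to \<rho> x \<xi> \<Longrightarrow> maps_to \<rho> y \<eta> \<Longrightarrow> \<xi> \<^bold>\<in> \<eta>"
proof -
  \<comment> \<open>Every value of an attempt at \<open>a\<close> exceeds some value of the same
    attempt at each \<open>R\<close>-predecessor of \<open>a\<close> in \<open>A\<close>.\<close>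
  define attempt where "attempt h \<longleftrightarrow> (\<forall>a \<beta>. maps_to h a \<beta> \<longrightarrow>
      ordinal \<beta> \<and> (\<forall>x. x \<^bold>\<in> A \<and> R x a \<longrightarrow> (\<exists>\<xi>. maps_to h x \<xi> \<and> \<xi> \<^bold>\<in> \<beta>)))" for h
  define bound where "bound a \<beta> \<longleftrightarrow> (\<exists>h. attempt h \<and> maps_to h a \<beta>)" for a \<beta>
  define rank where "rank a \<beta> \<longleftrightarrow> bound a \<beta> \<and> (\<forall>\<xi>. bound a \<xi> \<longrightarrow> \<beta> \<^bold>\<in> \<xi> \<or> \<beta> = \<xi>)" for a \<beta>
  have def_bound: "definable2 bound"
    unfolding bound_def attempt_def
    by (intro definable2I definable_intros definable_set_theory definable2D[OF R])
  then have def_rank: "definable2 rank"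
    unfolding rank_def by (intro definable2I definable_intros definable2D[OF def_bound])
  have ord: "ordinal \<beta>" if "bound a \<beta>" for a \<beta>
    using that unfolding bound_def attempt_def by blast
  have rank_ord: "ordinal \<beta>" if "rank a \<beta>" for a \<beta>
    using that ord unfolding rank_def by blast
  have rank_unique: "\<beta> = \<beta>'" if "rank a \<beta>" "rank a \<beta>'" for a \<beta> \<beta>'
    using that rank_ord[OF that(1)] ordinal_trans not_mem_self unfolding rank_def by blast
  have rank_ex: "\<exists>\<mu>. rank a \<mu> \<and> (\<mu> \<^bold>\<in> \<beta> \<or> \<mu> = \<beta>)" if b: "bound a \<beta>" for a \<beta>
  proof -
    have "definable (\<lambda>e. bound a (e 0))"
      by (rule definable2D[OF def_bound]) (intro definable_intros)+
    then obtain \<mu> where "bound a \<mu>" "\<And>\<xi>. ordinal \<xi> \<Longrightarrow> bound a \<xi> \<Longrightarrow> \<mu> \<^bold>\<in> \<xi> \<or> \<mu> = \<xi>"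
      using ord[OF b] b by (rule least_ordinal) (rule that)
    then show ?thesis
      using ord b unfolding rank_def by blast
  qed
  have rank_less: "\<exists>\<xi>. rank x \<xi> \<and> \<xi> \<^bold>\<in> \<beta>" if x: "x \<^bold>\<in> A" "R x a" "rank a \<beta>" for x a \<beta>
  proof -
    obtain h \<xi> where "attempt h" "maps_to h x \<xi>" "\<xi> \<^bold>\<in> \<beta>"
      using x unfolding rank_def bound_def attempt_def by blast
    then have "bound x \<xi>"
      unfolding bound_def by blast
    then show ?thesis
      using rank_ex ordinal_trans[OF rank_ord[OF x(3)] \<open>\<xi> \<^bold>\<in> \<beta>\<close>] \<open>\<xi> \<^bold>\<in> \<beta>\<close> by blast
  qed
  \<comment> \<open>Ranks are unique where they exist, so Replacement collects them, and \<sigma>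
    bounds them, before every element of \<open>A\<close> is known to have one.\<close>
  obtain C where C: "\<And>\<mu>. \<mu> \<^bold>\<in> C \<longleftrightarrow> (\<exists>x. x \<^bold>\<in> A \<and> rank x \<mu>)"
    by (rule definable_replacement[OF def_rank, of A]) (erule (1) rank_unique, rule that)
  have C_ord: "\<And>\<mu>. \<mu> \<^bold>\<in> C \<Longrightarrow> ordinal \<mu>"
    unfolding C using rank_ord by blast
  obtain \<sigma> where \<sigma>: "ordinal \<sigma>" "\<And>\<mu>. \<mu> \<^bold>\<in> C \<Longrightarrow> \<mu> \<^bold>\<in> \<sigma>"
    by (rule ordinal_above[of C]) (erule C_ord, rule that)
  have total: "\<exists>\<beta>. rank a \<beta>" if "a \<^bold>\<in> A" for a
  proof (rule ccontr)
    assume "\<nexists>\<beta>. rank a \<beta>"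
    have "definable (\<lambda>e. \<nexists>\<beta>. rank (e 0) \<beta>)"
      by (intro definable_intros definable2D[OF def_rank])
    then obtain D where D: "\<And>z. z \<^bold>\<in> D \<longleftrightarrow> z \<^bold>\<in> A \<and> (\<nexists>\<beta>. rank z \<beta>)"
      by (rule definable_separation) (rule that)
    have "nonempty D" "\<forall>x. x \<^bold>\<in> D \<longrightarrow> x \<^bold>\<in> A"
      unfolding nonempty_def D using that \<open>\<nexists>\<beta>. rank a \<beta>\<close> by blast+
    then obtain m where m: "m \<^bold>\<in> D" and min: "\<And>x. x \<^bold>\<in> D \<Longrightarrow> \<not> R x m"
      using wf unfolding wellfounded_on_def by blast
    have below: "\<exists>\<xi>. rank x \<xi>" if "x \<^bold>\<in> A" "R x m" for x
      using min[of x] that unfolding D by blast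
    obtain B where B: "\<And>z. z \<^bold>\<in> B \<longleftrightarrow> z \<^bold>\<in> C \<or> z = \<sigma>"
      by (rule insert_set) (rule that)
    \<comment> \<open>Here \<open>m\<close> is minimal among the elements without a rank. Keeping
      all existing ranks and sending \<open>m\<close> to \<sigma>, above them all, is an attempt, so
      \<open>m\<close> has a rank after all.\<close>
    have "definable2 (\<lambda>x \<beta>. rank x \<beta> \<or> x = m \<and> \<beta> = \<sigma>)"
      by (intro definable2I definable_intros definable2D[OF def_rank])
    then obtain h where
      h: "\<And>x \<beta>. maps_to h x \<beta> \<longleftrightarrow> x \<^bold>\<in> A \<and> \<beta> \<^bold>\<in> B \<and> (rank x \<beta> \<or> x = m \<and> \<beta> = \<sigma>)"
      by (rule relation_set) (rule that)
    have "attempt h"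
      unfolding attempt_def
    proof (intro allI impI conjI)
      fix a \<beta> assume a: "maps_to h a \<beta>"
      then show "ordinal \<beta>"
        using rank_ord \<sigma>(1) unfolding h by blast
      fix x assume x: "x \<^bold>\<in> A \<and> R x a"
      have "\<exists>\<xi>. rank x \<xi> \<and> \<xi> \<^bold>\<in> \<beta>"
      proof (cases "rank a \<beta>")
        case True
        then show ?thesis using rank_less x by blast
      next
        case False
        then have "a = m" "\<beta> = \<sigma>" using a unfolding h by blast+
        then show ?thesis using below x \<sigma>(2) C by blast
      qed
      then show "\<exists>\<xi>. maps_to h x \<xi> \<and> \<xi> \<^bold>\<in> \<beta>"
        unfolding h B C using x by blast
    qed
    moreover have "maps_to h m \<sigma>"
      using m unfolding h B D by blast
    ultimately show False
      using m rank_ex unfolding D bound_def by blast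
  qed
  obtain \<rho> where "function_to \<rho> A \<sigma>" and \<rho>: "\<And>x \<xi>. maps_to \<rho> x \<xi> \<longleftrightarrow> x \<^bold>\<in> A \<and> rank x \<xi>"
  proof (rule function_set[OF def_rank])
    show "\<exists>!\<beta>. rank x \<beta>" if "x \<^bold>\<in> A" for x
      using total[OF that] rank_unique by blast
    show "\<beta> \<^bold>\<in> \<sigma>" if "x \<^bold>\<in> A" "rank x \<beta>" for x \<beta>
      using that \<sigma>(2) C by blast
  qed (rule that)
  moreover have "\<xi> \<^bold>\<in> \<eta>" if "x \<^bold>\<in> A" "R x y" "maps_to \<rho> x \<xi>" "maps_to \<rho> y \<eta>" for x y \<xi> \<eta>
    using that rank_less[of x y \<eta>] rank_unique unfolding \<rho> by blast
  ultimately show thesis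
    using \<sigma>(1) that by blast
qed

subsection \<open>Wellfounded filters\<close>

lemma filter_on_subset: "filter_on X F \<Longrightarrow> A \<^bold>\<in> F \<Longrightarrow> A \<^bold>\<subseteq> X"
  unfolding filter_on_def by blast

lemma filter_on_upward: "filter_on X F \<Longrightarrow> A \<^bold>\<in> F \<Longrightarrow> A \<^bold>\<subseteq> B \<Longrightarrow> B \<^bold>\<subseteq> X \<Longrightarrow> B \<^bold>\<in> F"
  unfolding filter_on_def by blast

lemma filter_on_inter:
  assumes "filter_on X F" "A \<^bold>\<in> F" "B \<^bold>\<in> F"
  obtains C where "C \<^bold>\<in> F" "\<And>x. x \<^bold>\<in> C \<longleftrightarrow> x \<^bold>\<in> A \<and> x \<^bold>\<in> B"
proof -
  have "\<exists>C. C \<^bold>\<in> F \<and> is_set_of C (\<lambda>x. x \<^bold>\<in> A \<and> x \<^bold>\<in> B)"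
    using assms unfolding filter_on_def by blast
  then show thesis
    using that unfolding is_set_of_def by blast
qed

lemma almost_allE:
  assumes "almost_all X F P"
  obtains A where "A \<^bold>\<in> F" "\<And>x. x \<^bold>\<in> A \<longleftrightarrow> x \<^bold>\<in> X \<and> P x"
  using assms unfolding almost_all_def is_set_of_def by blast

text \<open>\<open>almost_all\<close> asserts that the set of good points exists in the structure,
  whence the definability premise. That set lies between \<open>A\<close> and \<open>X\<close>,
  hence in \<open>F\<close>.\<close>

lemma almost_allI:
  assumes "definable (\<lambda>e. P (e 0))" "filter_on X F" "A \<^bold>\<in> F" "\<And>x. x \<^bold>\<in> A \<Longrightarrow> P x"
  shows "almost_all X F P"
proof -
  obtain B where B: "\<And>x. x \<^bold>\<in> B \<longleftrightarrow> x \<^bold>\<in> X \<and> P x"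
    using assms(1) by (rule definable_separation) (rule that)
  have "A \<^bold>\<subseteq> B" "B \<^bold>\<subseteq> X"
    using filter_on_subset[OF assms(2,3)] assms(4) B unfolding subset_def by blast+
  then have "B \<^bold>\<in> F"
    using filter_on_upward assms(2,3) by blast
  then show ?thesis
    unfolding almost_all_def is_set_of_def using B by blast
qed

text \<open>The sets for \<open>P\<close> and \<open>Q\<close> come with \<open>almost_all\<close>,
  and the set for \<open>R\<close> is then a superset of their intersection. Where a single premise
  suffices, it is supplied twice.\<close>

lemma almost_all_mp:
  assumes "definable (\<lambda>e. R (e 0))" "filter_on X F" "almost_all X F P" "almost_all X F Q"
    and "\<And>x. x \<^bold>\<in> X \<Longrightarrow> P x \<Longrightarrow> Q x \<Longrightarrow> R x"
  shows "almost_all X F R"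
proof -
  obtain A where A: "A \<^bold>\<in> F" "\<And>x. x \<^bold>\<in> A \<longleftrightarrow> x \<^bold>\<in> X \<and> P x"
    using assms(3) by (rule almost_allE) (rule that)
  obtain B where B: "B \<^bold>\<in> F" "\<And>x. x \<^bold>\<in> B \<longleftrightarrow> x \<^bold>\<in> X \<and> Q x"
    using assms(4) by (rule almost_allE) (rule that)
  obtain C where C: "C \<^bold>\<in> F" "\<And>x. x \<^bold>\<in> C \<longleftrightarrow> x \<^bold>\<in> A \<and> x \<^bold>\<in> B"
    using assms(2) A(1) B(1) by (rule filter_on_inter) (rule that)
  show ?thesis
    using assms(1,2) C(1) by (rule almost_allI) (use A B C assms(5) in blast)
qed

lemma almost_all_mem: "filter_on X F \<Longrightarrow> A \<^bold>\<in> F \<Longrightarrow> almost_all X F (\<lambda>x. x \<^bold>\<in> A)"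
  by (rule almost_allI[of _ _ _ A]) (intro definable_intros)

lemma almost_all_ex: "filter_on X F \<Longrightarrow> almost_all X F P \<Longrightarrow> \<exists>x. x \<^bold>\<in> X \<and> P x"
  by (erule almost_allE) (use filter_onD(2) in \<open>unfold nonempty_def, blast\<close>)

lemma eq_mod_refl:
  assumes "filter_on X F" "function_to f X \<gamma>"
  shows "eq_mod X F f f"
  unfolding eq_mod_def
proof (rule almost_allI[of _ _ _ X])
  show "\<exists>y z. maps_to f x y \<and> maps_to f x z \<and> y = z" if "x \<^bold>\<in> X" for x
    using function_onD[of f X x] assms(2) that unfolding function_to_def by blast
qed (use assms(1) filter_onD in \<open>intro definable_intros | blast\<close>)+

text \<open>Passes from classes to representatives: by Replacement the classes of members of
  \<open>T\<close> form a set, and a member of \<open>T\<close> whose class is minimal there has no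
  member of \<open>T\<close> below it.\<close>

lemma wf_filter_less_mod_minimal:
  assumes F: "wf_filter X F" and \<gamma>: "ordinal \<gamma>" and T: "nonempty T"
    and fn: "\<And>f. f \<^bold>\<in> T \<Longrightarrow> function_to f X \<gamma>"
  obtains f where "f \<^bold>\<in> T" "\<And>g. g \<^bold>\<in> T \<Longrightarrow> \<not> less_mod X F g f"
proof -
  have filt: "filter_on X F"
    using F by (simp add: wf_filter_def)
  define cls where "cls f c \<longleftrightarrow> is_set_of c (\<lambda>g. function_to g X \<gamma> \<and> eq_mod X F f g)" for f c
  have def_cls: "definable2 cls"
    unfolding cls_def by (intro definable2I definable_intros definable_set_theory)
  have cls_unique: "c = d" if "cls f c" "cls f d" for f c d
    using that is_set_of_unique unfolding cls_def by blast
  obtain S where S: "\<And>c. c \<^bold>\<in> S \<longleftrightarrow> (\<exists>f. f \<^bold>\<in> T \<and> cls f c)"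
    by (rule definable_replacement[OF def_cls, of T]) (erule (1) cls_unique, rule that)
  have cls_ex: "\<exists>c. cls f c" if "f \<^bold>\<in> T" for f
  proof -
    obtain W where W: "\<And>f. f \<^bold>\<in> W \<longleftrightarrow> function_to f X \<gamma>"
      by (rule function_space) (rule that)
    have "definable (\<lambda>e. eq_mod X F f (e 0))"
      by (intro definable_intros definable_set_theory)
    then obtain c where "\<And>g. g \<^bold>\<in> c \<longleftrightarrow> g \<^bold>\<in> W \<and> eq_mod X F f g"
      by (rule definable_separation) (rule that)
    then show ?thesis
      unfolding cls_def is_set_of_def W by blast
  qed
  have "nonempty S"
    using T cls_ex unfolding nonempty_def S by blast
  moreover have "\<forall>c. c \<^bold>\<in> S \<longrightarrow> in_reduced_power \<gamma> X F c"
    unfolding S in_reduced_power_def cls_def using fn by blast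
  ultimately obtain c where c: "c \<^bold>\<in> S" "\<And>d. d \<^bold>\<in> S \<Longrightarrow> \<not> reduced_power_less X F d c"
    using F \<gamma> unfolding wf_filter_def wellfounded_on_def by meson
  then obtain f where f: "f \<^bold>\<in> T" "cls f c"
    unfolding S by blast
  have mem: "f \<^bold>\<in> c" if "f \<^bold>\<in> T" "cls f c" for f c
    using that eq_mod_refl[OF filt] fn unfolding cls_def is_set_of_def by blast
  have "\<not> less_mod X F g f" if g: "g \<^bold>\<in> T" for g
  proof
    assume "less_mod X F g f"
    moreover obtain d where "cls g d"
      using cls_ex[OF g] by blast
    ultimately have "reduced_power_less X F d c" "d \<^bold>\<in> S"
      unfolding reduced_power_less_def S using mem f g by blast+
    then show False
      using c(2) by blast
  qed
  then show thesis
    using f(1) that by blast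
qed

text \<open>Passes from representatives back to classes: the class of a minimal function in the
  union of \<open>S\<close> is minimal, because \<open>less_mod\<close> does not change when the
  right-hand function is replaced by an equivalent one.\<close>

lemma wf_filterI:
  assumes filt: "filter_on X F"
    and min: "\<And>\<gamma> T. ordinal \<gamma> \<Longrightarrow> nonempty T \<Longrightarrow> (\<And>f. f \<^bold>\<in> T \<Longrightarrow> function_to f X \<gamma>) \<Longrightarrow>
      \<exists>f. f \<^bold>\<in> T \<and> (\<forall>g. g \<^bold>\<in> T \<longrightarrow> \<not> less_mod X F g f)"
  shows "wf_filter X F"
  unfolding wf_filter_def wellfounded_on_def
proof (intro conjI allI impI filt, elim conjE)
  fix \<gamma> S assume \<gamma>: "ordinal \<gamma>" and "nonempty S" and S: "\<forall>c. c \<^bold>\<in> S \<longrightarrow> in_reduced_power \<gamma> X F c"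
  obtain T where T: "\<And>f. f \<^bold>\<in> T \<longleftrightarrow> (\<exists>c. c \<^bold>\<in> S \<and> f \<^bold>\<in> c)"
    by (rule union_set) (rule that)
  have cls: "\<exists>f. function_to f X \<gamma> \<and> (\<forall>g. g \<^bold>\<in> c \<longleftrightarrow> function_to g X \<gamma> \<and> eq_mod X F f g)"
    if "c \<^bold>\<in> S" for c
    using S that unfolding in_reduced_power_def is_set_of_def by blast
  obtain c where "c \<^bold>\<in> S"
    using \<open>nonempty S\<close> unfolding nonempty_def by blast
  then have "nonempty T"
    using cls[of c] eq_mod_refl[OF filt] unfolding nonempty_def T by blast
  moreover have "\<And>f. f \<^bold>\<in> T \<Longrightarrow> function_to f X \<gamma>"
    unfolding T using cls by blast
  ultimately obtain f where f: "f \<^bold>\<in> T" "\<And>g. g \<^bold>\<in> T \<Longrightarrow> \<not> less_mod X F g f"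
    using min[OF \<gamma>] by blast
  then obtain c where c: "c \<^bold>\<in> S" "f \<^bold>\<in> c"
    unfolding T by blast
  then obtain f0 where f0: "function_to f0 X \<gamma>"
    "\<And>g. g \<^bold>\<in> c \<longleftrightarrow> function_to g X \<gamma> \<and> eq_mod X F f0 g"
    using cls by blast
  have "\<not> reduced_power_less X F d c" if "d \<^bold>\<in> S" for d
  proof
    assume "reduced_power_less X F d c"
    then obtain g f' where g: "g \<^bold>\<in> d" "f' \<^bold>\<in> c" "less_mod X F g f'"
      unfolding reduced_power_less_def by blast
    have f': "function_to f' X \<gamma>" and eq: "eq_mod X F f0 f" "eq_mod X F f0 f'"
      using f0(2) c(2) g(2) by blast+
    have agree: "almost_all X F (\<lambda>x. \<exists>y. maps_to f x y \<and> maps_to f' x y)"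
    proof (rule almost_all_mp[OF _ filt eq[unfolded eq_mod_def]])
      show "definable (\<lambda>e. \<exists>y. maps_to f (e 0) y \<and> maps_to f' (e 0) y)"
        by (intro definable_intros)
    qed (use function_to_maps_to_unique[OF f0(1)] in blast)
    have "less_mod X F g f"
      unfolding less_mod_def
    proof (rule almost_all_mp[OF _ filt agree g(3)[unfolded less_mod_def]])
      show "definable (\<lambda>e. \<exists>y z. maps_to g (e 0) y \<and> maps_to f (e 0) z \<and> y \<^bold>\<in> z)"
        by (intro definable_intros)
    qed (use function_to_maps_to_unique[OF f'] in blast)
    moreover have "g \<^bold>\<in> T"
      unfolding T using g(1) that by blast
    ultimately show False
      using f(2) by blast
  qed
  then show "\<exists>c. c \<^bold>\<in> S \<and> \<not> (\<exists>d. d \<^bold>\<in> S \<and> reduced_power_less X F d c)"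
    using c(1) by blast
qed

text \<open>Ranking \<open>R x\<close> for all \<open>x\<close> at once turns \<open>t\<close> into the function sending \<open>x\<close> to the \<open>R x\<close>-rank
  of \<open>t\<close>, so that wellfoundedness of the reduced power applies without any choices.\<close>

lemma wf_filter_minimal:
  assumes F: "wf_filter X F" and R: "definable3 R" and T: "nonempty T"
    and wf: "\<And>x. x \<^bold>\<in> X \<Longrightarrow> wellfounded_on (\<lambda>t. t \<^bold>\<in> T) (R x)"
  obtains t where "t \<^bold>\<in> T" "\<And>u. u \<^bold>\<in> T \<Longrightarrow> \<not> almost_all X F (\<lambda>x. R x u t)"
proof -
  have filt: "filter_on X F"
    using F by (simp add: wf_filter_def)
  obtain A where A: "\<And>p. p \<^bold>\<in> A \<longleftrightarrow> (\<exists>x t. x \<^bold>\<in> X \<and> t \<^bold>\<in> T \<and> is_pair p x t)"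
    by (rule product_set) (rule that)
  \<comment> \<open>The disjoint union over \<open>x\<close> of the relations \<open>R x\<close>,
    living on the product of \<open>X\<close> and \<open>T\<close>; one rank function for
    \<open>Q\<close> handles all \<open>x\<close> simultaneously.\<close>
  define Q where "Q p q \<longleftrightarrow> (\<exists>x t u. is_pair p x u \<and> is_pair q x t \<and> R x u t)" for p q
  have def_Q: "definable2 Q"
    unfolding Q_def by (intro definable2I definable_intros definable3D[OF R])
  have "wellfounded_on (\<lambda>p. p \<^bold>\<in> A) Q"
    unfolding wellfounded_on_def
  proof (intro allI impI, elim conjE)
    fix S assume "nonempty S" and S: "\<forall>p. p \<^bold>\<in> S \<longrightarrow> p \<^bold>\<in> A"
    then obtain p0 x t0 where p0: "p0 \<^bold>\<in> S" "x \<^bold>\<in> X" "t0 \<^bold>\<in> T" "is_pair p0 x t0"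
      unfolding nonempty_def A by blast
    \<comment> \<open>\<open>Q\<close> never relates pairs with different first coordinates, so a
      minimal element of \<open>S\<close> can be sought in its slice at one
      \<open>x\<close>.\<close>
    have "definable (\<lambda>e. \<exists>p. p \<^bold>\<in> S \<and> is_pair p x (e 0))"
      by (intro definable_intros)
    then obtain S' where S': "\<And>t. t \<^bold>\<in> S' \<longleftrightarrow> t \<^bold>\<in> T \<and> (\<exists>p. p \<^bold>\<in> S \<and> is_pair p x t)"
      by (rule definable_separation) (rule that)
    have "nonempty S'" "\<forall>t. t \<^bold>\<in> S' \<longrightarrow> t \<^bold>\<in> T"
      unfolding nonempty_def S' using p0 by blast+
    then obtain t where t: "t \<^bold>\<in> S'" "\<And>u. u \<^bold>\<in> S' \<Longrightarrow> \<not> R x u t"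
      using wf[OF p0(2)] unfolding wellfounded_on_def by blast
    then obtain p where p: "p \<^bold>\<in> S" "is_pair p x t"
      unfolding S' by blast
    have "\<not> Q q p" if "q \<^bold>\<in> S" for q
    proof
      assume "Q q p"
      then obtain x' t' u where q: "is_pair q x' u" "is_pair p x' t'" "R x' u t'"
        unfolding Q_def by blast
      then have eq: "x' = x" "t' = t"
        using is_pair_inject p(2) by blast+
      have "u \<^bold>\<in> T"
        using S that q(1) is_pair_inject unfolding A by blast
      then show False
        using t(2) S' that q eq by blast
    qed
    then show "\<exists>m. m \<^bold>\<in> S \<and> \<not> (\<exists>q. q \<^bold>\<in> S \<and> Q q m)"
      using p(1) by blast
  qed
  then obtain \<gamma> \<rho> where \<gamma>: "ordinal \<gamma>" and \<rho>: "function_to \<rho> A \<gamma>"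
    and mono: "\<And>p q \<xi> \<eta>. p \<^bold>\<in> A \<Longrightarrow> Q p q \<Longrightarrow> maps_to \<rho> p \<xi> \<Longrightarrow> maps_to \<rho> q \<eta> \<Longrightarrow> \<xi> \<^bold>\<in> \<eta>"
    by (rule rank_function[OF def_Q]) (rule that)
  \<comment> \<open>The value of \<open>row t\<close> at \<open>x\<close> is the rank of the pair of
    \<open>x\<close> and \<open>t\<close>. A row is thus a function from \<open>X\<close> to
    \<gamma>, to which wellfoundedness of the reduced power applies.\<close>
  define rk where "rk t x \<xi> \<longleftrightarrow> (\<exists>p. is_pair p x t \<and> maps_to \<rho> p \<xi>)" for t x \<xi>
  define row where "row t f \<longleftrightarrow> function_to f X \<gamma> \<and> (\<forall>x \<xi>. maps_to f x \<xi> \<longleftrightarrow> x \<^bold>\<in> X \<and> rk t x \<xi>)"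
    for t f
  have def_row: "definable2 row"
    unfolding row_def rk_def by (intro definable2I definable_intros definable_set_theory)
  have row_ex: "\<exists>f. row t f" if t: "t \<^bold>\<in> T" for t
  proof -
    have def_rk: "definable2 (rk t)"
      unfolding rk_def by (intro definable2I definable_intros)
    have rk_ex1: "\<exists>!\<xi>. rk t x \<xi>" if x: "x \<^bold>\<in> X" for x
    proof -
      obtain p where p: "is_pair p x t" "p \<^bold>\<in> A"
        unfolding A using t x is_pair_ex by blast
      then have "rk t x \<xi> \<longleftrightarrow> maps_to \<rho> p \<xi>" for \<xi>
        unfolding rk_def using is_pair_unique by blast
      then show ?thesis
        using \<rho> p(2) unfolding function_to_def function_on_def by simp
    qed
    have rk_less: "\<xi> \<^bold>\<in> \<gamma>" if "rk t x \<xi>" for x \<xi>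
      using \<rho> that unfolding rk_def function_to_def by blast
    obtain f where "function_to f X \<gamma>" "\<And>x \<xi>. maps_to f x \<xi> \<longleftrightarrow> x \<^bold>\<in> X \<and> rk t x \<xi>"
      by (rule function_set[OF def_rk, of X]) (erule rk_ex1, erule rk_less, rule that)
    then show ?thesis
      unfolding row_def by blast
  qed
  obtain W where W: "\<And>f. f \<^bold>\<in> W \<longleftrightarrow> function_to f X \<gamma>"
    by (rule function_space) (rule that)
  have "definable (\<lambda>e. \<exists>t. t \<^bold>\<in> T \<and> row t (e 0))"
    by (intro definable_intros definable2D[OF def_row])
  then obtain T' where T': "\<And>f. f \<^bold>\<in> T' \<longleftrightarrow> f \<^bold>\<in> W \<and> (\<exists>t. t \<^bold>\<in> T \<and> row t f)"
    by (rule definable_separation) (rule that)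
  have "nonempty T'"
    using T row_ex unfolding nonempty_def T' W row_def by blast
  moreover have "\<And>f. f \<^bold>\<in> T' \<Longrightarrow> function_to f X \<gamma>"
    unfolding T' W by blast
  ultimately obtain f where f: "f \<^bold>\<in> T'" "\<And>g. g \<^bold>\<in> T' \<Longrightarrow> \<not> less_mod X F g f"
    by (rule wf_filter_less_mod_minimal[OF F \<gamma>]) (assumption, rule that)
  then obtain t where t: "t \<^bold>\<in> T" "row t f"
    unfolding T' by blast
  have "\<not> almost_all X F (\<lambda>x. R x u t)" if u: "u \<^bold>\<in> T" for u
  proof
    assume *: "almost_all X F (\<lambda>x. R x u t)"
    obtain g where g: "row u g"
      using row_ex[OF u] by blast
    have "less_mod X F g f"
      unfolding less_mod_def
    proof (rule almost_all_mp[OF _ filt * *])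
      fix x assume x: "x \<^bold>\<in> X" "R x u t"
      obtain p q where pq: "is_pair p x u" "is_pair q x t"
        using is_pair_ex by blast
      then have "Q p q" "p \<^bold>\<in> A"
        unfolding Q_def A using x u by blast+
      have "function_on g X" "function_on f X"
        using g t(2) unfolding row_def function_to_def by blast+
      then obtain \<xi> \<eta> where gf: "maps_to g x \<xi>" "maps_to f x \<eta>"
        using x(1) by (blast dest: function_onD)
      then have "rk u x \<xi>" "rk t x \<eta>"
        using g t(2) unfolding row_def by blast+
      then have "maps_to \<rho> p \<xi>" "maps_to \<rho> q \<eta>"
        unfolding rk_def using pq is_pair_unique by blast+
      then show "\<exists>y z. maps_to g x y \<and> maps_to f x z \<and> y \<^bold>\<in> z"
        using mono \<open>p \<^bold>\<in> A\<close> \<open>Q p q\<close> gf by blast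
    qed (intro definable_intros)
    moreover have "g \<^bold>\<in> T'"
      unfolding T' W using u g row_def by blast
    ultimately show False
      using f(2) by blast
  qed
  then show thesis
    using t(1) that by blast
qed

subsection \<open>Filter limits\<close>

lemma is_filter_limitD:
  "is_filter_limit X F s L \<Longrightarrow>
    B \<^bold>\<in> L \<longleftrightarrow> B \<^bold>\<subseteq> X \<and> almost_all X F (\<lambda>x. \<exists>H. maps_to s x H \<and> B \<^bold>\<in> H)"
  by (simp add: is_filter_limit_def is_set_of_def)

lemma filter_limit_ex: "\<exists>L. is_filter_limit X F s L"
proof -
  obtain W where W: "\<And>B. B \<^bold>\<in> W \<longleftrightarrow> B \<^bold>\<subseteq> X"
    by (rule powerset_set) (rule that)
  have "definable (\<lambda>e. almost_all X F (\<lambda>x. \<exists>H. maps_to s x H \<and> e 0 \<^bold>\<in> H))"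
    unfolding almost_all_def by (intro definable_intros)
  then obtain L where
    "\<And>B. B \<^bold>\<in> L \<longleftrightarrow> B \<^bold>\<in> W \<and> almost_all X F (\<lambda>x. \<exists>H. maps_to s x H \<and> B \<^bold>\<in> H)"
    by (rule definable_separation) (rule that)
  then show ?thesis
    unfolding is_filter_limit_def is_set_of_def W by blast
qed

text \<open>The filter laws hold in each value of \<open>s\<close>, and they pass to
  \<open>L\<close> because almost-all statements modulo \<open>F\<close> can be combined.\<close>

lemma filter_on_limit:
  assumes F: "filter_on X F" and s: "function_on s X"
    and sf: "\<And>x H. x \<^bold>\<in> X \<Longrightarrow> maps_to s x H \<Longrightarrow> filter_on X H"
    and L: "is_filter_limit X F s L"
  shows "filter_on X L"
  unfolding filter_on_def
proof (intro conjI allI impI; (elim conjE)?)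
  note mem = is_filter_limitD[OF L]
  show "A \<^bold>\<subseteq> X" if "A \<^bold>\<in> L" for A
    using that mem by blast
  show "X \<^bold>\<in> L"
  proof -
    have "almost_all X F (\<lambda>x. \<exists>H. maps_to s x H \<and> X \<^bold>\<in> H)"
    proof (rule almost_allI[OF _ F filter_onD(1)[OF F]])
      show "\<exists>H. maps_to s x H \<and> X \<^bold>\<in> H" if "x \<^bold>\<in> X" for x
        using function_onD[OF s that] sf[OF that] filter_onD(1) by blast
    qed (intro definable_intros)
    then show ?thesis
      unfolding mem subset_def by blast
  qed
  show "nonempty A" if "A \<^bold>\<in> L" for A
  proof -
    have "almost_all X F (\<lambda>x. \<exists>H. maps_to s x H \<and> A \<^bold>\<in> H)"
      using that mem by blast
    then show ?thesis
      using almost_all_ex[OF F] sf filter_onD(2) by blast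
  qed
  show "B \<^bold>\<in> L" if "A \<^bold>\<in> L" "A \<^bold>\<subseteq> B" "B \<^bold>\<subseteq> X" for A B
  proof -
    have *: "almost_all X F (\<lambda>x. \<exists>H. maps_to s x H \<and> A \<^bold>\<in> H)"
      using that(1) mem by blast
    have "almost_all X F (\<lambda>x. \<exists>H. maps_to s x H \<and> B \<^bold>\<in> H)"
    proof (rule almost_all_mp[OF _ F * *])
      show "\<exists>H. maps_to s x H \<and> B \<^bold>\<in> H" if "x \<^bold>\<in> X" "\<exists>H. maps_to s x H \<and> A \<^bold>\<in> H" for x
        using that sf filter_on_upward[OF _ _ \<open>A \<^bold>\<subseteq> B\<close> \<open>B \<^bold>\<subseteq> X\<close>] by blast
    qed (intro definable_intros)
    then show ?thesis
      unfolding mem using that(3) by blast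
  qed
  show "\<exists>C. C \<^bold>\<in> L \<and> is_set_of C (\<lambda>x. x \<^bold>\<in> A \<and> x \<^bold>\<in> B)" if A: "A \<^bold>\<in> L" and B: "B \<^bold>\<in> L" for A B
  proof -
    have "definable (\<lambda>e. e 0 \<^bold>\<in> B)"
      by (intro definable_intros)
    then obtain C where C: "\<And>x. x \<^bold>\<in> C \<longleftrightarrow> x \<^bold>\<in> A \<and> x \<^bold>\<in> B"
      by (rule definable_separation) (rule that)
    have AB: "almost_all X F (\<lambda>x. \<exists>H. maps_to s x H \<and> A \<^bold>\<in> H)"
      "almost_all X F (\<lambda>x. \<exists>H. maps_to s x H \<and> B \<^bold>\<in> H)"
      using A B mem by blast+
    have "almost_all X F (\<lambda>x. \<exists>H. maps_to s x H \<and> C \<^bold>\<in> H)"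
    proof (rule almost_all_mp[OF _ F AB])
      fix x assume x: "x \<^bold>\<in> X" "\<exists>H. maps_to s x H \<and> A \<^bold>\<in> H" "\<exists>H. maps_to s x H \<and> B \<^bold>\<in> H"
      then obtain H where H: "maps_to s x H" "A \<^bold>\<in> H" "B \<^bold>\<in> H"
        using function_on_maps_to_unique[OF s] by blast
      then obtain C' where C': "C' \<^bold>\<in> H" "\<And>x. x \<^bold>\<in> C' \<longleftrightarrow> x \<^bold>\<in> A \<and> x \<^bold>\<in> B"
        using filter_on_inter[OF sf[OF x(1) H(1)]] by blast
      \<comment> \<open>\<open>C'\<close> was obtained for the particular filter \<open>H\<close>;
        extensionality identifies it with the one \<open>C\<close> chosen for all indices.\<close>
      have "C' = C"
        by (rule set_eqI) (simp only: C C'(2))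
      then show "\<exists>H. maps_to s x H \<and> C \<^bold>\<in> H"
        using H(1) C'(1) by blast
    qed (intro definable_intros)
    moreover have "C \<^bold>\<subseteq> X"
      using A mem C unfolding subset_def by blast
    ultimately show ?thesis
      unfolding is_set_of_def using mem C by blast
  qed
qed

text \<open>If \<open>g\<close> is below \<open>f\<close> modulo \<open>L\<close>, then
  \<open>g\<close> is below \<open>f\<close> modulo the value of \<open>s\<close> at
  \<open>F\<close>-almost every index. So it suffices to minimise the indexed family of these
  relations by \<open>wf_filter_minimal\<close>.\<close>

lemma wf_filter_limit:
  assumes F: "wf_filter X F" and s: "function_on s X"
    and sf: "\<And>x H. x \<^bold>\<in> X \<Longrightarrow> maps_to s x H \<Longrightarrow> filter_on X H"
    and swf: "almost_all X F (\<lambda>x. \<exists>H. maps_to s x H \<and> wf_filter X H)"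
    and L: "is_filter_limit X F s L"
  shows "wf_filter X L"
proof (rule wf_filterI)
  have filt: "filter_on X F"
    using F by (simp add: wf_filter_def)
  show "filter_on X L"
    using filt s sf L by (rule filter_on_limit)
  fix \<gamma> T assume \<gamma>: "ordinal \<gamma>" and T: "nonempty T"
    and fn: "\<And>f. f \<^bold>\<in> T \<Longrightarrow> function_to f X \<gamma>"
  define R where "R x g f \<longleftrightarrow> (\<exists>H. maps_to s x H \<and> wf_filter X H \<and> less_mod X H g f)" for x g f
  have def_R: "definable3 R"
    unfolding R_def by (intro definable3I definable_intros definable_set_theory)
  have "wellfounded_on (\<lambda>f. f \<^bold>\<in> T) (R x)" for x
    unfolding wellfounded_on_def
  proof (intro allI impI, elim conjE)
    fix S assume S: "nonempty S" "\<forall>f. f \<^bold>\<in> S \<longrightarrow> f \<^bold>\<in> T"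
    show "\<exists>f. f \<^bold>\<in> S \<and> \<not> (\<exists>g. g \<^bold>\<in> S \<and> R x g f)"
    \<comment> \<open>Where \<open>s\<close> has no wellfounded filter as its value,
      \<open>R x\<close> is empty and every element of \<open>S\<close> is minimal.\<close>
    proof (cases "\<exists>H. maps_to s x H \<and> wf_filter X H")
      case True
      then obtain H where H: "maps_to s x H" "wf_filter X H"
        by blast
      obtain f where "f \<^bold>\<in> S" "\<And>g. g \<^bold>\<in> S \<Longrightarrow> \<not> less_mod X H g f"
        using wf_filter_less_mod_minimal[OF H(2) \<gamma> S(1)] fn S(2) by blast
      then show ?thesis
        unfolding R_def using function_on_maps_to_unique[OF s H(1)] by blast
    next
      case False
      then show ?thesis
        using S(1) unfolding R_def nonempty_def by blast
    qed
  qed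
  then obtain f where f: "f \<^bold>\<in> T" "\<And>g. g \<^bold>\<in> T \<Longrightarrow> \<not> almost_all X F (\<lambda>x. R x g f)"
    by (rule wf_filter_minimal[OF F def_R T]) (rule that)
  have "\<not> less_mod X L g f" if g: "g \<^bold>\<in> T" for g
  proof
    assume "less_mod X L g f"
    then obtain B where B: "B \<^bold>\<in> L"
      "is_set_of B (\<lambda>x. x \<^bold>\<in> X \<and> (\<exists>y z. maps_to g x y \<and> maps_to f x z \<and> y \<^bold>\<in> z))"
      unfolding less_mod_def almost_all_def by blast
    have less: "less_mod X H g f" if "B \<^bold>\<in> H" for H
      unfolding less_mod_def almost_all_def using that B(2) by blast
    have *: "almost_all X F (\<lambda>x. \<exists>H. maps_to s x H \<and> B \<^bold>\<in> H)"
      using is_filter_limitD[OF L] B(1) by blast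
    have "almost_all X F (\<lambda>x. R x g f)"
    proof (rule almost_all_mp[OF _ filt swf *])
      show "definable (\<lambda>e. R (e 0) g f)"
        by (rule definable3D[OF def_R]) (intro definable_intros)+
    qed (use function_on_maps_to_unique[OF s] less in \<open>unfold R_def, blast\<close>)
    then show False
      using f(2)[OF g] by blast
  qed
  then show "\<exists>f. f \<^bold>\<in> T \<and> (\<forall>g. g \<^bold>\<in> T \<longrightarrow> \<not> less_mod X L g f)"
    using f(1) by blast
qed

section \<open>Composing and minimising witnesses, and the induction along \<delta>\<close>

lemma filters_set:
  obtains W where "\<And>F. filter_on \<delta> F \<Longrightarrow> F \<^bold>\<in> W"
proof -
  obtain V where V: "\<And>z. z \<^bold>\<in> V \<longleftrightarrow> z \<^bold>\<subseteq> \<delta>"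
    by (rule powerset_set) (rule that)
  obtain W where W: "\<And>z. z \<^bold>\<in> W \<longleftrightarrow> z \<^bold>\<subseteq> V"
    by (rule powerset_set) (rule that)
  have "F \<^bold>\<in> W" if "filter_on \<delta> F" for F
    unfolding W subset_def[of F] V using filter_on_subset[OF that] by blast
  then show thesis
    by (rule that)
qed

text \<open>Since \<open>F \<subseteq> G-lim\<^bsub>x\<^esub> F\<^sub>x\<close> and \<open>E \<subseteq> F-lim\<^bsub>y\<^esub> E\<^sub>y\<close>, we have \<open>E \<subseteq> G-lim\<^bsub>x\<^esub> (F\<^sub>x-lim\<^bsub>y\<^esub> E\<^sub>y)\<close>; and
  \<open>F\<^sub>x-lim\<^bsub>y\<^esub> E\<^sub>y\<close> contains \<open>x\<close> and lies Ketonen below \<open>F\<^sub>x\<close>.\<close>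

lemma ketonen_witness_compose:
  assumes \<delta>: "ordinal \<delta>" and G: "wf_filter \<delta> G" and F: "wf_filter \<delta> F"
    and s: "ketonen_witness \<delta> F G s" and t: "ketonen_witness \<delta> E F t"
  obtains s' where "ketonen_witness \<delta> E G s'"
    "almost_all \<delta> G (\<lambda>x. pointwise_ketonen_less \<delta> x s' s)"
proof -
  have filtG: "filter_on \<delta> G"
    using G by (simp add: wf_filter_def)
  have sfun: "function_on s \<delta>"
    and sf: "\<And>x H. x \<^bold>\<in> \<delta> \<Longrightarrow> maps_to s x H \<Longrightarrow> filter_on \<delta> H"
    and swf: "almost_all \<delta> G (\<lambda>x. \<exists>H. maps_to s x H \<and> wf_filter_at \<delta> x H)"
    using s unfolding ketonen_witness_def by blast+
  obtain L where L: "is_filter_limit \<delta> G s L" "F \<^bold>\<subseteq> L"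
    using s unfolding ketonen_witness_def by blast
  have tfun: "function_on t \<delta>"
    and tf: "\<And>x H. x \<^bold>\<in> \<delta> \<Longrightarrow> maps_to t x H \<Longrightarrow> filter_on \<delta> H"
    and twf: "almost_all \<delta> F (\<lambda>x. \<exists>H. maps_to t x H \<and> wf_filter_at \<delta> x H)"
    using t unfolding ketonen_witness_def by blast+
  obtain K where K: "is_filter_limit \<delta> F t K" "E \<^bold>\<subseteq> K"
    using t unfolding ketonen_witness_def by blast
  have F_mem: "almost_all \<delta> G (\<lambda>x. \<exists>H. maps_to s x H \<and> B \<^bold>\<in> H)" if "B \<^bold>\<in> F" for B
    using that L(2) is_filter_limitD[OF L(1)] unfolding subset_def[of F] by blast
  \<comment> \<open>The graph of the composed sequence: the value at \<open>x\<close> is the limit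
    of \<open>t\<close> along the filter that \<open>s\<close> assigns to \<open>x\<close>.\<close>
  define P where "P x M \<longleftrightarrow> (\<exists>H. maps_to s x H \<and> is_filter_limit \<delta> H t M)" for x M
  have def_P: "definable2 P"
    unfolding P_def by (intro definable2I definable_intros definable_set_theory)
  obtain W where W: "\<And>H. filter_on \<delta> H \<Longrightarrow> H \<^bold>\<in> W"
    by (rule filters_set) (rule that)
  have P_filter: "filter_on \<delta> M" if x: "x \<^bold>\<in> \<delta>" and M: "P x M" for x M
  proof -
    obtain H where H: "maps_to s x H" "is_filter_limit \<delta> H t M"
      using M unfolding P_def by blast
    show ?thesis
      by (rule filter_on_limit[OF sf[OF x H(1)] tfun _ H(2)]) (erule (1) tf)
  qed
  have P_ex1: "\<exists>!M. P x M" if x: "x \<^bold>\<in> \<delta>" for x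
  proof -
    obtain H where H: "maps_to s x H"
      using function_onD[OF sfun x] by blast
    then have *: "P x M \<longleftrightarrow> is_filter_limit \<delta> H t M" for M
      unfolding P_def using function_on_maps_to_unique[OF sfun] by blast
    obtain M where M: "is_filter_limit \<delta> H t M"
      using filter_limit_ex by blast
    have "M' = M" if "is_filter_limit \<delta> H t M'" for M'
      using that M unfolding is_filter_limit_def by (rule is_set_of_unique)
    then show ?thesis
      unfolding * using M by blast
  qed
  obtain s' where s': "function_to s' \<delta> W" "\<And>x M. maps_to s' x M \<longleftrightarrow> x \<^bold>\<in> \<delta> \<and> P x M"
    by (rule function_set[OF def_P, of \<delta>]) (erule P_ex1, rule W, erule (1) P_filter, rule that)
  obtain A where A: "A \<^bold>\<in> F"
    "\<And>y. y \<^bold>\<in> A \<longleftrightarrow> y \<^bold>\<in> \<delta> \<and> (\<exists>H. maps_to t y H \<and> wf_filter_at \<delta> y H)"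
    using twf by (rule almost_allE) (rule that)
  have def_less: "definable (\<lambda>e. pointwise_ketonen_less \<delta> (e 0) s' s)"
    by (intro definable_intros definable_pointwise_ketonen_less)
  \<comment> \<open>\<open>A\<close> lies in \<open>F\<close>, which is contained in the limit of
    \<open>s\<close> along \<open>G\<close>. Hence \<open>A\<close> belongs to the value of
    \<open>s\<close> at \<open>G\<close>-almost every \<open>x\<close>, and only such
    \<open>x\<close> are considered.\<close>
  have less: "almost_all \<delta> G (\<lambda>x. pointwise_ketonen_less \<delta> x s' s)"
  proof (rule almost_all_mp[OF def_less filtG F_mem[OF A(1)] swf])
    fix x assume x: "x \<^bold>\<in> \<delta>" and 1: "\<exists>H. maps_to s x H \<and> A \<^bold>\<in> H"
      and 2: "\<exists>H. maps_to s x H \<and> wf_filter_at \<delta> x H"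
    then obtain H where H: "maps_to s x H" "A \<^bold>\<in> H" "wf_filter_at \<delta> x H"
      using function_on_maps_to_unique[OF sfun] by blast
    then have Hwf: "wf_filter \<delta> H" and xH: "x \<^bold>\<in> H" and Hf: "filter_on \<delta> H"
      by (simp_all add: wf_filter_at_def wf_filter_def)
    obtain M where M: "maps_to s' x M" "is_filter_limit \<delta> H t M"
      using P_ex1[OF x] x function_on_maps_to_unique[OF sfun H(1)] unfolding s'(2) P_def by blast
    have def_wf: "definable (\<lambda>e. \<exists>H. maps_to t (e 0) H \<and> wf_filter \<delta> H)"
      by (intro definable_intros definable_set_theory)
    have twfH: "almost_all \<delta> H (\<lambda>y. \<exists>H. maps_to t y H \<and> wf_filter \<delta> H)"
      by (rule almost_allI[OF def_wf Hf H(2)]) (use A(2) wf_filter_at_def in blast)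
    have Mwf: "wf_filter \<delta> M"
      by (rule wf_filter_limit[OF Hwf tfun _ twfH M(2)]) (erule (1) tf)
    \<comment> \<open>For \<open>y\<close> in both \<open>A\<close> and \<open>x\<close>, the value
      of \<open>t\<close> at \<open>y\<close> contains \<open>y\<close>, hence its superset
      \<open>x\<close>. As these \<open>y\<close> form a set in \<open>H\<close>, the limit
      \<open>M\<close> contains \<open>x\<close>.\<close>
    obtain C where C: "C \<^bold>\<in> H" "\<And>y. y \<^bold>\<in> C \<longleftrightarrow> y \<^bold>\<in> A \<and> y \<^bold>\<in> x"
      using Hf H(2) xH by (rule filter_on_inter) (rule that)
    have x_sub: "x \<^bold>\<subseteq> \<delta>"
      using filter_on_subset[OF Hf xH] .
    have "almost_all \<delta> H (\<lambda>y. \<exists>H. maps_to t y H \<and> x \<^bold>\<in> H)"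
    proof (rule almost_allI[OF _ Hf C(1)])
      fix y assume "y \<^bold>\<in> C"
      then have y: "y \<^bold>\<in> A" "y \<^bold>\<in> x"
        using C(2) by blast+
      then obtain H' where H': "maps_to t y H'" "wf_filter_at \<delta> y H'"
        using A(2) by blast
      have "y \<^bold>\<subseteq> x"
        using ordinal_trans[OF ordinal_element[OF \<delta> x] y(2)] unfolding subset_def by blast
      then have "x \<^bold>\<in> H'"
        using H'(2) x_sub filter_on_upward unfolding wf_filter_at_def wf_filter_def by blast
      then show "\<exists>H. maps_to t y H \<and> x \<^bold>\<in> H"
        using H'(1) by blast
    qed (intro definable_intros)
    then have "x \<^bold>\<in> M"
      using is_filter_limitD[OF M(2)] x_sub by blast
    then have M_at: "wf_filter_at \<delta> x M"
      unfolding wf_filter_at_def using Mwf by blast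
    \<comment> \<open>The original sequence \<open>t\<close> also witnesses that \<open>M\<close> is
      below \<open>H\<close>, since \<open>M\<close> is exactly its limit along
      \<open>H\<close>.\<close>
    have "almost_all \<delta> H (\<lambda>y. \<exists>H. maps_to t y H \<and> wf_filter_at \<delta> y H)"
      unfolding almost_all_def is_set_of_def using H(2) A(2) by blast
    then have "ketonen_witness \<delta> M H t"
      unfolding ketonen_witness_def using tfun tf M(2) subset_def[of M M] by blast
    then have "ketonen_less_ae \<delta> M H"
      unfolding ketonen_less_ae_iff using Mwf Hwf by blast
    then show "pointwise_ketonen_less \<delta> x s' s"
      unfolding pointwise_ketonen_less_def using M(1) H(1,3) M_at by blast
  qed
  have s'fun: "function_on s' \<delta>"
    using s'(1) by (simp add: function_to_def)
  have s'f: "\<forall>x H. x \<^bold>\<in> \<delta> \<and> maps_to s' x H \<longrightarrow> filter_on \<delta> H"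
    using s'(2) P_filter by blast
  have "definable (\<lambda>e. \<exists>H. maps_to s' (e 0) H \<and> wf_filter_at \<delta> (e 0) H)"
    by (intro definable_intros definable_set_theory)
  then have s'wf: "almost_all \<delta> G (\<lambda>x. \<exists>H. maps_to s' x H \<and> wf_filter_at \<delta> x H)"
    by (rule almost_all_mp[OF _ filtG less less]) (unfold pointwise_ketonen_less_def, blast)
  obtain N where N: "is_filter_limit \<delta> G s' N"
    using filter_limit_ex by blast
  have "B \<^bold>\<in> N" if "B \<^bold>\<in> E" for B
  proof -
    have B: "B \<^bold>\<subseteq> \<delta>" "almost_all \<delta> F (\<lambda>y. \<exists>H. maps_to t y H \<and> B \<^bold>\<in> H)"
      using that K(2) is_filter_limitD[OF K(1)] unfolding subset_def[of E] by blast+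
    \<comment> \<open>Iterated limits: \<open>C\<close> is in \<open>F\<close>, so it is in the
      value of \<open>s\<close> at \<open>G\<close>-almost every \<open>x\<close>, which puts
      \<open>B\<close> into the value of \<open>s'\<close> there.\<close>
    obtain C where C: "C \<^bold>\<in> F" "\<And>y. y \<^bold>\<in> C \<longleftrightarrow> y \<^bold>\<in> \<delta> \<and> (\<exists>H. maps_to t y H \<and> B \<^bold>\<in> H)"
      using B(2) by (rule almost_allE) (rule that)
    have "almost_all \<delta> G (\<lambda>x. \<exists>H. maps_to s' x H \<and> B \<^bold>\<in> H)"
    proof (rule almost_all_mp[OF _ filtG F_mem[OF C(1)] F_mem[OF C(1)]])
      fix x assume x: "x \<^bold>\<in> \<delta>" "\<exists>H. maps_to s x H \<and> C \<^bold>\<in> H"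
      then obtain H where H: "maps_to s x H" "C \<^bold>\<in> H"
        by blast
      then obtain M where M: "maps_to s' x M" "is_filter_limit \<delta> H t M"
        using P_ex1[OF x(1)] x(1) function_on_maps_to_unique[OF sfun H(1)]
        unfolding s'(2) P_def by blast
      have "almost_all \<delta> H (\<lambda>y. \<exists>H. maps_to t y H \<and> B \<^bold>\<in> H)"
        unfolding almost_all_def is_set_of_def using H(2) C(2) by blast
      then show "\<exists>H. maps_to s' x H \<and> B \<^bold>\<in> H"
        using M is_filter_limitD[OF M(2)] B(1) by blast
    qed (intro definable_intros)
    then show ?thesis
      using is_filter_limitD[OF N] B(1) by blast
  qed
  then have "ketonen_witness \<delta> E G s'"
    unfolding ketonen_witness_def using s'fun s'f s'wf N subset_def[of E N] by blast
  then show thesis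
    using less by (rule that)
qed

text \<open>The hypothesis below \<alpha> suffices because every filter in question contains
  \<alpha>, so almost all indices lie in \<alpha>. The lemma is applied to members of \<delta> and
  finally to \<delta> itself.\<close>

lemma ketonen_wellfounded_step:
  assumes \<delta>: "ordinal \<delta>"
    and below: "\<And>x. x \<^bold>\<in> \<alpha> \<Longrightarrow> wellfounded_on (wf_filter_at \<delta> x) (ketonen_less_ae \<delta>)"
  shows "wellfounded_on (wf_filter_at \<delta> \<alpha>) (ketonen_less_ae \<delta>)"
  unfolding wellfounded_on_def
proof (intro allI impI, elim conjE, rule ccontr)
  fix S assume "nonempty S" and S: "\<forall>F. F \<^bold>\<in> S \<longrightarrow> wf_filter_at \<delta> \<alpha> F"
  assume "\<not> (\<exists>G. G \<^bold>\<in> S \<and> \<not> (\<exists>F. F \<^bold>\<in> S \<and> ketonen_less_ae \<delta> F G))"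
  then have lower: "\<exists>F s. F \<^bold>\<in> S \<and> ketonen_witness \<delta> F G s" if "G \<^bold>\<in> S" for G
    using that unfolding ketonen_less_ae_iff by blast
  have Swf: "wf_filter \<delta> F" if "F \<^bold>\<in> S" for F
    using S that unfolding wf_filter_at_def by blast
  obtain G where G: "G \<^bold>\<in> S"
    using \<open>nonempty S\<close> unfolding nonempty_def by blast
  have filtG: "filter_on \<delta> G" and \<alpha>G: "\<alpha> \<^bold>\<in> G"
    using S G unfolding wf_filter_at_def wf_filter_def by blast+
  obtain W where W: "\<And>H. filter_on \<delta> H \<Longrightarrow> H \<^bold>\<in> W"
    by (rule filters_set) (rule that)
  obtain Z where Z: "\<And>s. s \<^bold>\<in> Z \<longleftrightarrow> function_to s \<delta> W"
    by (rule function_space) (rule that)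
  have "definable (\<lambda>e. \<exists>F. F \<^bold>\<in> S \<and> ketonen_witness \<delta> F G (e 0))"
    by (intro definable_intros definable_ketonen_witness)
  then obtain T where T': "\<And>s. s \<^bold>\<in> T \<longleftrightarrow> s \<^bold>\<in> Z \<and> (\<exists>F. F \<^bold>\<in> S \<and> ketonen_witness \<delta> F G s)"
    by (rule definable_separation) (rule that)
  \<comment> \<open>All values of a witness are filters, even at indices outside the
    \<open>G\<close>-large set, so the witnesses form a set \<open>T\<close> of functions into
    \<open>W\<close>.\<close>
  have "s \<^bold>\<in> Z" if "ketonen_witness \<delta> F G s" for F s
    using that W function_on_dom
    unfolding Z ketonen_witness_def function_to_def by blast
  then have T: "s \<^bold>\<in> T \<longleftrightarrow> (\<exists>F. F \<^bold>\<in> S \<and> ketonen_witness \<delta> F G s)" for s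
    unfolding T' by blast
  have Tfun: "function_on s \<delta>" if "s \<^bold>\<in> T" for s
    using that unfolding T ketonen_witness_def by blast
  define R where "R x s' s \<longleftrightarrow> x \<^bold>\<in> \<alpha> \<and> pointwise_ketonen_less \<delta> x s' s" for x s' s
  have def_R: "definable3 R"
    unfolding R_def by (intro definable3I definable_intros definable_pointwise_ketonen_less)
  have wfR: "wellfounded_on (\<lambda>s. s \<^bold>\<in> T) (R x)" for x
    unfolding wellfounded_on_def
  proof (intro allI impI, elim conjE)
    fix U assume "nonempty U" and U: "\<forall>s. s \<^bold>\<in> U \<longrightarrow> s \<^bold>\<in> T"
    \<comment> \<open>\<open>D\<close> collects the values at \<open>x\<close> of the sequences in
      \<open>U\<close>. A sequence attaining a minimal value is minimal for \<open>R x\<close>; if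
      \<open>D\<close> is empty or \<open>x\<close> is not in \<alpha>, then \<open>R x\<close> is
      empty on \<open>U\<close>.\<close>
    have "definable (\<lambda>e. wf_filter_at \<delta> x (e 0) \<and> (\<exists>s. s \<^bold>\<in> U \<and> maps_to s x (e 0)))"
      by (intro definable_intros definable_set_theory)
    then obtain D where
      D: "\<And>H. H \<^bold>\<in> D \<longleftrightarrow> H \<^bold>\<in> W \<and> wf_filter_at \<delta> x H \<and> (\<exists>s. s \<^bold>\<in> U \<and> maps_to s x H)"
      by (rule definable_separation) (rule that)
    have D': "H \<^bold>\<in> D \<longleftrightarrow> wf_filter_at \<delta> x H \<and> (\<exists>s. s \<^bold>\<in> U \<and> maps_to s x H)" for H
      unfolding D using W[of H] unfolding wf_filter_at_def wf_filter_def by blast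
    show "\<exists>s. s \<^bold>\<in> U \<and> \<not> (\<exists>s'. s' \<^bold>\<in> U \<and> R x s' s)"
    proof (cases "x \<^bold>\<in> \<alpha> \<and> nonempty D")
      case True
      moreover have "\<forall>H. H \<^bold>\<in> D \<longrightarrow> wf_filter_at \<delta> x H"
        unfolding D' by blast
      ultimately obtain H where H: "H \<^bold>\<in> D" "\<And>H'. H' \<^bold>\<in> D \<Longrightarrow> \<not> ketonen_less_ae \<delta> H' H"
        using below[of x] unfolding wellfounded_on_def by blast
      then obtain s where s: "s \<^bold>\<in> U" "maps_to s x H"
        unfolding D' by blast
      have "\<not> R x s' s" if "s' \<^bold>\<in> U" for s'
      proof
        assume "R x s' s"
        then obtain H' H1 where "maps_to s' x H'" "maps_to s x H1" "wf_filter_at \<delta> x H'"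
          "ketonen_less_ae \<delta> H' H1"
          unfolding R_def pointwise_ketonen_less_def by blast
        moreover from this have "H1 = H"
          using function_on_maps_to_unique[OF Tfun] U s by blast
        ultimately show False
          using H(2) that unfolding D' by blast
      qed
      then show ?thesis
        using s(1) by blast
    next
      case False
      then show ?thesis
        using \<open>nonempty U\<close> unfolding R_def pointwise_ketonen_less_def nonempty_def D' by blast
    qed
  qed
  have "nonempty T"
    unfolding nonempty_def T using lower[OF G] by blast
  then obtain s where s: "s \<^bold>\<in> T" "\<And>s'. s' \<^bold>\<in> T \<Longrightarrow> \<not> almost_all \<delta> G (\<lambda>x. R x s' s)"
    using wfR by (rule wf_filter_minimal[OF Swf[OF G] def_R]) (rule that)
  then obtain F where F: "F \<^bold>\<in> S" "ketonen_witness \<delta> F G s"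
    unfolding T by blast
  \<comment> \<open>Two descents in \<open>S\<close>, from \<open>G\<close> to \<open>F\<close> and
    from \<open>F\<close> to \<open>E\<close>, compose to a witness \<open>s'\<close> that again
    belongs to \<open>T\<close> and undercuts the minimal \<open>s\<close>.\<close>
  obtain E t where E: "E \<^bold>\<in> S" "ketonen_witness \<delta> E F t"
    using lower[OF F(1)] by blast
  obtain s' where s': "ketonen_witness \<delta> E G s'"
    "almost_all \<delta> G (\<lambda>x. pointwise_ketonen_less \<delta> x s' s)"
    using \<delta> Swf[OF G] Swf[OF F(1)] F(2) E(2) by (rule ketonen_witness_compose) (rule that)
  have "definable (\<lambda>e. R (e 0) s' s)"
    by (rule definable3D[OF def_R]) (intro definable_intros)+
  then have "almost_all \<delta> G (\<lambda>x. R x s' s)"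
    by (rule almost_all_mp[OF _ filtG almost_all_mem[OF filtG \<alpha>G] s'(2)]) (simp add: R_def)
  then show False
    using s(2) s'(1) E(1) T by blast
qed

text \<open>Induction reaches every \<alpha> in \<delta>, and one more step reaches \<delta>. Since
  every filter on \<delta> contains \<delta>, \<open>wf_filter_at \<delta> \<delta>\<close> is
  \<open>wf_filter \<delta>\<close>.\<close>

lemma ketonen_less_ae_wellfounded:
  assumes \<delta>: "ordinal \<delta>"
  shows "wellfounded_on (wf_filter \<delta>) (ketonen_less_ae \<delta>)"
proof -
  have at: "wellfounded_on (wf_filter_at \<delta> \<alpha>) (ketonen_less_ae \<delta>)" if \<alpha>: "\<alpha> \<^bold>\<in> \<delta>" for \<alpha>
  proof (rule ccontr)
    assume bad: "\<not> wellfounded_on (wf_filter_at \<delta> \<alpha>) (ketonen_less_ae \<delta>)"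
    \<comment> \<open>\<open>wellfounded_on\<close> quantifies over sets of the structure only, so
      the counterexamples in \<delta> can be separated out and Foundation gives a least one.\<close>
    have "definable (\<lambda>e. \<not> wellfounded_on (wf_filter_at \<delta> (e 0)) (ketonen_less_ae \<delta>))"
      unfolding wellfounded_on_def by (intro definable_intros definable_set_theory)
    then obtain D where D: "\<And>x. x \<^bold>\<in> D \<longleftrightarrow>
        x \<^bold>\<in> \<delta> \<and> \<not> wellfounded_on (wf_filter_at \<delta> x) (ketonen_less_ae \<delta>)"
      by (rule definable_separation) (rule that)
    have "nonempty D"
      unfolding nonempty_def D using \<alpha> bad by blast
    then obtain m where m: "m \<^bold>\<in> D" "\<And>x. x \<^bold>\<in> m \<Longrightarrow> \<not> x \<^bold>\<in> D"
      using foundation[of D] by blast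
    then have "wellfounded_on (wf_filter_at \<delta> m) (ketonen_less_ae \<delta>)"
      using ketonen_wellfounded_step[OF \<delta>] ordinal_trans[OF \<delta>] unfolding D by blast
    then show False
      using m(1) unfolding D by blast
  qed
  have "wellfounded_on (wf_filter_at \<delta> \<delta>) (ketonen_less_ae \<delta>)"
    by (rule ketonen_wellfounded_step[OF \<delta>]) (rule at)
  moreover have "wf_filter_at \<delta> \<delta> F \<longleftrightarrow> wf_filter \<delta> F" for F
    unfolding wf_filter_at_def wf_filter_def using filter_onD(1) by blast
  ultimately show ?thesis
    unfolding wellfounded_on_def by simp
qed

end

theorem theorem4p2:
  fixes mem :: "'v \<Rightarrow> 'v \<Rightarrow> bool" and \<delta> :: 'v
  assumes "ZF_model mem"
    and "set_structure.ordinal mem \<delta>"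
  shows "set_structure.wellfounded_on mem
           (set_structure.wf_filter mem \<delta>) (set_structure.ketonen_less mem \<delta>) \<and>
         set_structure.wellfounded_on mem
           (set_structure.wf_filter mem \<delta>) (set_structure.ketonen_less_ae mem \<delta>)"
proof -
  interpret ZF_model mem
    by (rule assms(1))
  have "wellfounded_on (wf_filter \<delta>) (ketonen_less_ae \<delta>)"
    by (rule ketonen_less_ae_wellfounded[OF assms(2)])
  \<comment> \<open>An element minimal for \<open>ketonen_less_ae\<close> is minimal for the
    subrelation \<open>ketonen_less\<close>.\<close>
  moreover from this have "wellfounded_on (wf_filter \<delta>) (ketonen_less \<delta>)"
    unfolding wellfounded_on_def using ketonen_less_imp_ae by meson
  ultimately show ?thesis
    by blast
qed

end
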